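(* Let $X,Y$ be real nonzero Banach spaces, $T:Y\rightrightarrows Y^*$ a maximal monotone operator of Gossez type (D) with strong representative function $h_T$, and $A:X\to Y$ linear continuous with $\operatorname{pr}_Y(\operatorname{dom}h_T)\cap\operatorname{im}A\neq\emptyset$. Assume one of: (a) $0\in{}^{ic}\big(\operatorname{pr}_Y(\operatorname{dom}h_T)-\operatorname{im}A\big)$; (b) the set $\{(A^*v^*,v^{**},r): r\in\mathbb R,\ h_T^*(v^*,v^{**})\le r\}$ is closed regarding $X^*\times\operatorname{im}A^{**}\times\mathbb R$ in $(X^*,w^* )\times(Y^{**},w^* )\times\mathbb R$. Then $h:=\operatorname{cl}_{\|\cdot\|\times\|\cdot\|_*}h_T^A$ is a strong representative function of $A^*TA$, and $A^*TA:X\rightrightarrows X^*$ is maximal monotone of Gossez type (D).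
   Context: Spaces are identified with their images in their biduals. Coupling $c(y,y^* )=\langle y^*,y\rangle$. Conjugate of $h$ on $Y\times Y^*$: $h^*(y^*,y^{**})=\sup_{(y,z^* )}\{\langle y^*,y\rangle+\langle y^{**},z^*\rangle-h(y,z^* )\}$ (analogously on $X\times X^*$). Representative function of monotone $T$: convex norm-lsc $h_T$ with $h_T\ge c$ and $G(T)\subseteq\{h_T=c\}$; strong if $h_T^*(y^*,y^{**})\ge\langle y^{**},y^*\rangle$ for all. Gossez's closure $\overline T:Y^{**}\rightrightarrows Y^*$ has graph $\{(y^{**},y^* ):\langle y^{**}-z,y^*-z^*\rangle\ge0\ \forall(z,z^* )\in G(T)\}$; maximal monotone $T$ is of Gossez type (D) if each point of $G(\overline T)$ is the $w^*\times\|\cdot\|_*$-limit of a bounded net in $G(T)$. $A^*,A^{**}$ adjoint and biadjoint; $\operatorname{im}A=A(X)$; $A^*TA(x)=A^*(T(Ax))$. $h_T^A(x,x^* )=\inf\{h_T(Ax,v^* ):v^*\in Y^*,\ A^*v^*=x^*\}$. Closed regarding $W$: $\operatorname{cl}D\cap W=D\cap W$. ${}^{ic}D=\operatorname{icr}D$ if $\operatorname{aff}D$ closed, else $\emptyset$, with $\operatorname{icr}D=\{u:\forall x\in\operatorname{aff}(D-D)\ \exists\delta>0\ \forall\lambda\in[0,\delta]:u+\lambda x\in D\}$. *)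

theory Defs
  imports "HOL-Analysis.Analysis"
begin

type_synonym 'a dual = "'a \<Rightarrow>\<^sub>L real"
type_synonym 'a bidual = "('a \<Rightarrow>\<^sub>L real) \<Rightarrow>\<^sub>L real"

definition bidual_emb :: "'a::real_normed_vector \<Rightarrow> 'a bidual" where
  "bidual_emb x = Blinfun (\<lambda>f. blinfun_apply f x)"

definition wstar :: "('a::real_normed_vector \<Rightarrow>\<^sub>L real) topology" where
  "wstar = pullback_topology UNIV blinfun_apply (product_topology (\<lambda>_. euclideanreal) UNIV)"

definition coupling :: "'a::real_normed_vector \<times> 'a dual \<Rightarrow> ereal" where
  "coupling p = ereal (blinfun_apply (snd p) (fst p))"

definition fconj :: "('a::real_normed_vector \<times> 'a dual \<Rightarrow> ereal) \<Rightarrow> 'a dual \<times> 'a bidual \<Rightarrow> ereal" where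
  "fconj h q = (SUP p. ereal (blinfun_apply (fst q) (fst p) + blinfun_apply (snd q) (snd p)) - h p)"

definition epigraph :: "('b \<Rightarrow> ereal) \<Rightarrow> ('b \<times> real) set" where
  "epigraph f = {(p, r). f p \<le> ereal r}"

definition ereal_convex :: "('b::real_vector \<Rightarrow> ereal) \<Rightarrow> bool" where
  "ereal_convex f \<longleftrightarrow> convex (epigraph f)"

definition ereal_lsc :: "('b::topological_space \<Rightarrow> ereal) \<Rightarrow> bool" where
  "ereal_lsc f \<longleftrightarrow> closed (epigraph f)"

definition lsc_hull :: "('b::topological_space \<Rightarrow> ereal) \<Rightarrow> 'b \<Rightarrow> ereal" where
  "lsc_hull f p = Inf {ereal r | r. (p, r) \<in> closure (epigraph f)}"

definition effdom :: "('b \<Rightarrow> ereal) \<Rightarrow> 'b set" where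
  "effdom f = {p. f p < \<infinity>}"

text \<open>Monotone operators are given by their graphs G(T) \<subseteq> X \<times> X*.\<close>
definition monotone_op :: "('a::real_normed_vector \<times> 'a dual) set \<Rightarrow> bool" where
  "monotone_op G \<longleftrightarrow> (\<forall>(x, u) \<in> G. \<forall>(y, v) \<in> G. blinfun_apply (u - v) (x - y) \<ge> 0)"

definition maximal_monotone :: "('a::real_normed_vector \<times> 'a dual) set \<Rightarrow> bool" where
  "maximal_monotone G \<longleftrightarrow> monotone_op G \<and>
     (\<forall>x u. (\<forall>(y, v) \<in> G. blinfun_apply (u - v) (x - y) \<ge> 0) \<longrightarrow> (x, u) \<in> G)"

definition gossez_closure :: "('a::real_normed_vector \<times> 'a dual) set \<Rightarrow> ('a bidual \<times> 'a dual) set" where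
  "gossez_closure G = {(w, u). \<forall>(z, v) \<in> G. blinfun_apply (w - bidual_emb z) (u - v) \<ge> 0}"

text \<open>Gossez type (D): every point of the Gossez closure is the (w* \<times> norm)-limit of a bounded
  net in G(T). Nets are expressed by proper filters on X \<times> X* (a net in G(T) is a proper filter
  eventually contained in G(T); bounded means eventually in a bounded subset).\<close>
definition gossez_D :: "('a::banach \<times> 'a dual) set \<Rightarrow> bool" where
  "gossez_D G \<longleftrightarrow> maximal_monotone G \<and>
     (\<forall>(w, u) \<in> gossez_closure G. \<exists>F :: ('a \<times> 'a dual) filter. F \<noteq> bot \<and>
        (\<exists>B. bounded B \<and> eventually (\<lambda>p. p \<in> G \<inter> B) F) \<and>
        limitin wstar (\<lambda>p. bidual_emb (fst p)) w F \<and>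
        ((\<lambda>p. snd p) \<longlongrightarrow> u) F)"

definition representative :: "('a::real_normed_vector \<times> 'a dual \<Rightarrow> ereal) \<Rightarrow> ('a \<times> 'a dual) set \<Rightarrow> bool" where
  "representative h G \<longleftrightarrow> ereal_convex h \<and> ereal_lsc h \<and>
     (\<forall>p. h p \<ge> coupling p) \<and> (\<forall>p \<in> G. h p = coupling p)"

definition strong_representative :: "('a::real_normed_vector \<times> 'a dual \<Rightarrow> ereal) \<Rightarrow> ('a \<times> 'a dual) set \<Rightarrow> bool" where
  "strong_representative h G \<longleftrightarrow> representative h G \<and>
     (\<forall>u w. fconj h (u, w) \<ge> ereal (blinfun_apply w u))"

definition adjoint :: "('a::real_normed_vector \<Rightarrow>\<^sub>L 'b::real_normed_vector) \<Rightarrow> 'b dual \<Rightarrow> 'a dual" where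
  "adjoint A v = v o\<^sub>L A"

definition biadjoint :: "('a::real_normed_vector \<Rightarrow>\<^sub>L 'b::real_normed_vector) \<Rightarrow> 'a bidual \<Rightarrow> 'b bidual" where
  "biadjoint A w = w o\<^sub>L Blinfun (adjoint A)"

definition comp_op :: "('a::real_normed_vector \<Rightarrow>\<^sub>L 'b::real_normed_vector) \<Rightarrow> ('b \<times> 'b dual) set \<Rightarrow> ('a \<times> 'a dual) set" where
  "comp_op A G = {(x, adjoint A v) | x v. (blinfun_apply A x, v) \<in> G}"

definition rep_comp :: "('a::real_normed_vector \<Rightarrow>\<^sub>L 'b::real_normed_vector) \<Rightarrow> ('b \<times> 'b dual \<Rightarrow> ereal) \<Rightarrow> 'a \<times> 'a dual \<Rightarrow> ereal" where
  "rep_comp A h p = Inf {h (blinfun_apply A (fst p), v) | v. adjoint A v = snd p}"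

definition set_diff_mink :: "'b::real_vector set \<Rightarrow> 'b set \<Rightarrow> 'b set" where
  "set_diff_mink C D = {c - d | c d. c \<in> C \<and> d \<in> D}"

definition icr :: "'b::real_vector set \<Rightarrow> 'b set" where
  "icr D = {u. \<forall>x \<in> affine hull (set_diff_mink D D). \<exists>\<delta>>0. \<forall>t\<in>{0..\<delta>}. u + t *\<^sub>R x \<in> D}"

definition ic :: "'b::real_normed_vector set \<Rightarrow> 'b set" where
  "ic D = (if closed (affine hull D) then icr D else {})"

definition closed_regarding :: "'b topology \<Rightarrow> 'b set \<Rightarrow> 'b set \<Rightarrow> bool" where
  "closed_regarding \<tau> D W \<longleftrightarrow> (\<tau> closure_of D) \<inter> W = D \<inter> W"

end

theory Submission
  imports Defs
begin

text \<open>Write H for the closed hull of the composed function and c for the coupling.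
  Either of the two conditions makes the conjugate of H exact: if H* (u, w) \<le> \<alpha>, then some v with
  A*v = u satisfies hT* (v, A** w) \<le> \<alpha>. Under (a) this is an Attouch-Brezis argument
  (Baire's theorem and convex series), under (b) a weak* separation combined with Fenchel-Moreau.
  Hence H* \<ge> c, and at a point (x, u) with H = c the vector v obtained for w = x is
  monotonically related to G at A x, so that (x, u) lies in the graph of the composition.

  For a strong representative function h, type (D) of {h = c} is obtained directly. Given (w, u) in the
  Gossez closure and a weak* neighbourhood C of w in a ball, minimise
  h(x, v) + k d(x, C) - u x + \<sigma>_C(u - v) over |u - v| \<le> k, where \<sigma>_C is the support function.
  By Fenchel duality and h* \<ge> c the infimum is at most 0, an almost minimiser is close to the graph
  (Bronsted-Rockafellar), and being monotonically related to (w, u) then forces x to be near C and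
  v to be near u.\<close>

section \<open>Hahn-Banach and Fenchel duality\<close>

text \<open>Extended-valued functions are handled through their epigraphs: after
  \<open>fconj_le_iff\<close> the duality arguments are real inequalities. All separation takes one
  form, passing from b \<le> P e + k on a convex set of pairs to b \<le> L e + k with L linear and
  below P. The choice of P fixes the topology: a multiple of the norm makes L bounded, a finite sum
  of absolute evaluations makes L a point of the predual. The obstacle for type (D) is that the
  multiplier dual to v lives in the bidual and need not come from a point of the space. The penalty
  is built so that this does no harm: its two summands are conjugate to each other, and testing the
  dual inequality at v equal to the multiplier in the dual cancels the one in the bidual. The cutoff
  |u - v| \<le> k arises from conjugating k d(., C), and k is taken larger than the distance from u
  to some v0 in the domain, which provides the qualification for Fenchel duality. C is left general
  because it serves twice: a norm ball gives maximality, weak-star slabs in a ball give the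
  nets.\<close>

definition sublinear :: "('e::real_vector \<Rightarrow> real) \<Rightarrow> bool" where
  "sublinear P \<longleftrightarrow> (\<forall>x y. P (x + y) \<le> P x + P y) \<and> (\<forall>c x. 0 \<le> c \<longrightarrow> P (c *\<^sub>R x) = c * P x)"

lemma sublinearD:
  assumes "sublinear P"
  shows "P (x + y) \<le> P x + P y" "0 \<le> c \<Longrightarrow> P (c *\<^sub>R x) = c * P x"
  using assms unfolding sublinear_def by auto

lemma sublinear_zero: "sublinear P \<Longrightarrow> P 0 = 0"
  using sublinearD(2)[of P 0 0] by simp

lemma sublinear_ge_neg: "sublinear P \<Longrightarrow> - P (- x) \<le> P x"
  using sublinearD(1)[of P x "-x"] sublinear_zero[of P] by simp

text \<open>\<open>Q\<close> is the largest sublinear functional below \<open>P\<close> with Q (- e)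
  \<le> k on \<open>S\<close>: any such functional satisfies Q x \<le> Q (x + t e) + t Q (- e) \<le>
  P (x + t e) + t k. The hypothesis on \<open>S\<close> keeps the infimum finite. A single pair will
  show that minimal functionals are odd, a whole convex set yields Mazur-Orlicz.\<close>

lemma sublinear_lower:
  fixes P :: "'e::real_vector \<Rightarrow> real" and S :: "('e \<times> real) set"
  assumes P: "sublinear P" and S: "convex S" "S \<noteq> {}"
    and ge: "\<And>e k. (e, k) \<in> S \<Longrightarrow> 0 \<le> P e + k"
  shows "\<exists>Q. sublinear Q \<and> (\<forall>x. Q x \<le> P x) \<and> (\<forall>(e, k)\<in>S. Q (- e) \<le> k)"
proof -
  define V where "V x = {P (x + t *\<^sub>R e) + t * k | t e k. 0 \<le> t \<and> (e, k) \<in> S}" for x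
  define Q where "Q x = Inf (V x)" for x
  have Vne: "V x \<noteq> {}" for x
    using S(2) unfolding V_def by fastforce
  have lb: "- P (- x) \<le> v" if v: "v \<in> V x" for x v
  proof -
    obtain t e k where v: "v = P (x + t *\<^sub>R e) + t * k" "0 \<le> t" "(e, k) \<in> S"
      using v unfolding V_def by blast
    have "P (t *\<^sub>R e) \<le> P (x + t *\<^sub>R e) + P (- x)"
      using sublinearD(1)[OF P, of "x + t *\<^sub>R e" "- x"] by simp
    moreover have "0 \<le> t * (P e + k)"
      using v ge by simp
    ultimately show ?thesis
      using v sublinearD(2)[OF P, of t e] by (simp add: algebra_simps)
  qed
  have bdd: "bdd_below (V x)" for x
    using lb by (auto intro!: bdd_belowI)
  have Qle: "Q x \<le> P (x + t *\<^sub>R e) + t * k" if "0 \<le> t" "(e, k) \<in> S" for x t e k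
    unfolding Q_def by (rule cInf_lower[OF _ bdd]) (use that in \<open>auto simp: V_def\<close>)
  have Qge: "b \<le> Q x" if "\<And>t e k. 0 \<le> t \<Longrightarrow> (e, k) \<in> S \<Longrightarrow> b \<le> P (x + t *\<^sub>R e) + t * k" for b x
    unfolding Q_def by (rule cInf_greatest[OF Vne]) (use that in \<open>auto simp: V_def\<close>)
  obtain e0 k0 where ek0: "(e0, k0) \<in> S"
    using S(2) by auto
  have QP: "Q x \<le> P x" for x
    using Qle[of 0 e0 k0 x] ek0 by simp
  have Q0: "Q 0 = 0"
  proof (rule antisym)
    show "Q 0 \<le> 0" using QP[of 0] sublinear_zero[OF P] by simp
    show "0 \<le> Q 0"
    proof (rule Qge)
      fix t :: real and e k assume "0 \<le> t" "(e, k) \<in> S"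
      then show "0 \<le> P (0 + t *\<^sub>R e) + t * k"
        using lb[of "P (0 + t *\<^sub>R e) + t * k" 0] sublinear_zero[OF P] unfolding V_def by auto
    qed
  qed
  have sub: "Q (x + y) \<le> Q x + Q y" for x y
  proof -
    have "Q (x + y) - (P (y + t' *\<^sub>R e') + t' * k') \<le> P (x + t *\<^sub>R e) + t * k"
      if a: "0 \<le> t" "(e, k) \<in> S" "0 \<le> t'" "(e', k') \<in> S" for t e k t' e' k'
    proof (cases "t + t' = 0")
      case True
      then have "t = 0" "t' = 0" using a by auto
      then show ?thesis using QP[of "x + y"] sublinearD(1)[OF P, of x y] by simp
    next
      case False
      define s where "s = t + t'"
      have s: "s > 0" using False a unfolding s_def by simp
      \<comment> \<open>Two rays are merged into one by averaging their base points with weights t /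
        s and t' / s; this is where convexity of \<open>S\<close> enters.\<close>
      define u where "u = (t / s) *\<^sub>R (e, k) + (t' / s) *\<^sub>R (e', k')"
      have u: "u \<in> S"
        unfolding u_def by (rule convexD[OF S(1)]) (use a s in \<open>auto simp: s_def add_divide_distrib[symmetric]\<close>)
      have "s *\<^sub>R fst u = t *\<^sub>R e + t' *\<^sub>R e'" "s * snd u = t * k + t' * k'"
        using s by (auto simp: u_def algebra_simps)
      then have "Q (x + y) \<le> P ((x + t *\<^sub>R e) + (y + t' *\<^sub>R e')) + (t * k + t' * k')"
        using Qle[of s "fst u" "snd u" "x + y"] u s by (simp add: algebra_simps)
      then show ?thesis
        using sublinearD(1)[OF P, of "x + t *\<^sub>R e" "y + t' *\<^sub>R e'"] by simp
    qed
    then have "Q (x + y) - (P (y + t' *\<^sub>R e') + t' * k') \<le> Q x"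
      if "0 \<le> t'" "(e', k') \<in> S" for t' e' k'
      using that by (intro Qge) auto
    then have "Q (x + y) - Q x \<le> Q y"
      by (intro Qge) (simp add: algebra_simps)
    then show ?thesis by simp
  qed
  have hom_le: "Q (c *\<^sub>R x) \<le> c * Q x" if c: "0 < c" for c x
  proof -
    have "Q (c *\<^sub>R x) / c \<le> P (x + t *\<^sub>R e) + t * k" if "0 \<le> t" "(e, k) \<in> S" for t e k
    proof -
      have "Q (c *\<^sub>R x) \<le> P (c *\<^sub>R x + (c * t) *\<^sub>R e) + (c * t) * k"
        using Qle[of "c * t" e k] that c by simp
      also have "P (c *\<^sub>R x + (c * t) *\<^sub>R e) = c * P (x + t *\<^sub>R e)"
        using sublinearD(2)[OF P, of c "x + t *\<^sub>R e"] c by (simp add: scaleR_add_right)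
      finally show ?thesis using c by (simp add: field_simps)
    qed
    then have "Q (c *\<^sub>R x) / c \<le> Q x" by (rule Qge)
    then show ?thesis using c by (simp add: field_simps)
  qed
  have hom: "Q (c *\<^sub>R x) = c * Q x" if c: "0 \<le> c" for c x
  proof (cases "c = 0")
    case True
    then show ?thesis using Q0 by simp
  next
    case False
    with c have c: "c > 0" by simp
    have "Q x \<le> inverse c * Q (c *\<^sub>R x)"
      using hom_le[of "inverse c" "c *\<^sub>R x"] c by simp
    then show ?thesis
      using hom_le[OF c, of x] c by (simp add: field_simps)
  qed
  have "Q (- e) \<le> k" if "(e, k) \<in> S" for e k
    using Qle[of 1 e k "- e"] that sublinear_zero[OF P] by simp
  then show ?thesis
    using QP sub hom unfolding sublinear_def by (intro exI[of _ Q]) auto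
qed

text \<open>A minimal sublinear functional is odd, hence linear.\<close>
theorem sublinear_dominates_linear:
  fixes P :: "'e::real_vector \<Rightarrow> real"
  assumes P: "sublinear P"
  shows "\<exists>L. linear L \<and> (\<forall>x. L x \<le> P x)"
proof -
  define A where "A = {Q. sublinear Q \<and> (\<forall>x. Q x \<le> P x)}"
  define R where "R = (\<lambda>Q Q' :: 'e \<Rightarrow> real. \<forall>x. Q' x \<le> Q x)"
  have "\<exists>m\<in>A. \<forall>a\<in>A. R m a \<longrightarrow> a = m"
  proof (rule predicate_Zorn)
    show "partial_order_on A (relation_of R A)"
      unfolding relation_of_def partial_order_on_def preorder_on_def
    proof (intro conjI refl_onI transI antisymI)
      fix Q Q' Q'' assume "(Q, Q') \<in> {(a, b) \<in> A \<times> A. R a b}" "(Q', Q'') \<in> {(a, b) \<in> A \<times> A. R a b}"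
      then show "(Q, Q'') \<in> {(a, b) \<in> A \<times> A. R a b}"
        unfolding R_def using order_trans by blast
    next
      fix Q Q' assume "(Q, Q') \<in> {(a, b) \<in> A \<times> A. R a b}" "(Q', Q) \<in> {(a, b) \<in> A \<times> A. R a b}"
      then show "Q = Q'"
        unfolding R_def by (intro ext antisym) auto
    qed (auto simp: R_def)
  next
    fix C assume C: "C \<in> Chains (relation_of R A)"
    have CA: "Q \<in> A" if "Q \<in> C" for Q
      using C that unfolding Chains_def relation_of_def by auto
    have ch: "(\<forall>x. Q' x \<le> Q x) \<or> (\<forall>x. Q x \<le> Q' x)" if "Q \<in> C" "Q' \<in> C" for Q Q'
      using C that unfolding Chains_def relation_of_def R_def by blast
    show "\<exists>u\<in>A. \<forall>a\<in>C. R a u"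
    proof (cases "C = {}")
      case True
      then show ?thesis using P unfolding A_def by auto
    next
      case False
      define I where "I x = (INF Q\<in>C. Q x)" for x
      have bdd: "bdd_below ((\<lambda>Q. Q x) ` C)" for x
      proof (rule bdd_belowI)
        fix v assume "v \<in> (\<lambda>Q. Q x) ` C"
        then obtain Q where Q: "Q \<in> C" "v = Q x" by auto
        then have "- Q (- x) \<le> Q x" "Q (- x) \<le> P (- x)"
          using CA sublinear_ge_neg unfolding A_def by auto
        then show "- P (- x) \<le> v" using Q by simp
      qed
      have Ile: "I x \<le> Q x" if "Q \<in> C" for Q x
        unfolding I_def by (rule cINF_lower[OF bdd that])
      have Ige: "b \<le> I x" if "\<And>Q. Q \<in> C \<Longrightarrow> b \<le> Q x" for b x
        unfolding I_def using False that by (rule cINF_greatest)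
      have sub: "I (x + y) \<le> I x + I y" for x y
      proof -
        have "I (x + y) - Q' y \<le> Q x" if QC: "Q \<in> C" "Q' \<in> C" for Q Q'
        proof -
          obtain Q'' where Q'': "Q'' \<in> C" "\<forall>x. Q'' x \<le> Q x" "\<forall>x. Q'' x \<le> Q' x"
            using ch[OF QC] QC by blast
          have "I (x + y) \<le> Q'' x + Q'' y"
            using Ile[of Q'' "x + y"] CA[of Q''] sublinearD(1)[of Q'' x y] Q''(1) unfolding A_def by simp
          also have "\<dots> \<le> Q x + Q' y" using Q'' by (simp add: add_mono)
          finally show ?thesis by simp
        qed
        then have "I (x + y) - Q' y \<le> I x" if "Q' \<in> C" for Q'
          using that by (intro Ige) auto
        then have "I (x + y) - I x \<le> I y"
          by (intro Ige) (simp add: algebra_simps)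
        then show ?thesis by simp
      qed
      have hom: "I (c *\<^sub>R x) = c * I x" if c: "0 \<le> c" for c x
      proof (cases "c = 0")
        case True
        have "(\<lambda>Q. Q 0) ` C = {0::real}"
          using False CA sublinear_zero unfolding A_def by (auto simp: image_iff)
        then show ?thesis using True unfolding I_def by simp
      next
        case False
        with c have c: "c > 0" by simp
        have *: "Q (c *\<^sub>R x) = c * Q x" if "Q \<in> C" for Q
          using CA[OF that] sublinearD(2)[of Q c x] c unfolding A_def by simp
        have "I (c *\<^sub>R x) / c \<le> I x"
        proof (rule Ige)
          fix Q assume "Q \<in> C"
          then show "I (c *\<^sub>R x) / c \<le> Q x"
            using Ile[of Q "c *\<^sub>R x"] * c by (simp add: field_simps)
        qed
        moreover have "c * I x \<le> I (c *\<^sub>R x)"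
        proof (rule Ige)
          fix Q assume "Q \<in> C"
          then show "c * I x \<le> Q (c *\<^sub>R x)"
            using Ile[of Q x] *[of Q] c by simp
        qed
        ultimately show ?thesis using c by (simp add: field_simps)
      qed
      have "I x \<le> P x" for x
      proof -
        obtain Q where "Q \<in> C" using False by auto
        then show ?thesis using Ile[of Q x] CA[of Q] unfolding A_def by (auto intro: order_trans)
      qed
      then have "I \<in> A"
        unfolding A_def sublinear_def using sub hom by blast
      then show ?thesis using Ile unfolding R_def by auto
    qed
  qed
  then obtain q where qA: "q \<in> A" and min: "\<And>a. a \<in> A \<Longrightarrow> (\<forall>x. a x \<le> q x) \<Longrightarrow> a = q"
    unfolding R_def by blast
  have q: "sublinear q" and qP: "\<And>x. q x \<le> P x" using qA unfolding A_def by auto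
  have odd: "q (- a) = - q a" for a
  proof -
    obtain Q where Q: "sublinear Q" "\<And>x. Q x \<le> q x" "Q (- a) \<le> - q a"
      using sublinear_lower[OF q, of "{(a, - q a)}"] by auto
    moreover have "Q \<in> A" unfolding A_def using Q(1) order_trans[OF Q(2) qP] by auto
    ultimately have "Q = q" using min by blast
    then show ?thesis using Q(3) sublinear_ge_neg[OF q, of a] by simp
  qed
  have "linear q"
  proof (rule linearI)
    fix x y
    have "q (- x + - y) \<le> q (- x) + q (- y)" using sublinearD(1)[OF q] by blast
    then have "- q (x + y) \<le> - q x - q y" using odd[of "x + y"] odd[of x] odd[of y] by simp
    then show "q (x + y) = q x + q y" using sublinearD(1)[OF q, of x y] by simp
  next
    fix c :: real and x
    show "q (c *\<^sub>R x) = c *\<^sub>R q x"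
    proof (cases "c \<ge> 0")
      case True then show ?thesis using sublinearD(2)[OF q] by simp
    next
      case False
      then have "q (- c *\<^sub>R x) = - c * q x" using sublinearD(2)[OF q, of "-c" x] by simp
      then show ?thesis using odd[of "c *\<^sub>R x"] by simp
    qed
  qed
  then show ?thesis using qP by blast
qed

text \<open>Subtracting b from the offsets allows P to be lowered to Q with Q (- e) \<le> k - b, and
  every linear L below Q inherits L e \<ge> b - k.\<close>

theorem mazur_orlicz:
  fixes P :: "'e::real_vector \<Rightarrow> real" and S :: "('e \<times> real) set"
  assumes P: "sublinear P" and S: "convex S" "S \<noteq> {}"
    and ge: "\<And>e k. (e, k) \<in> S \<Longrightarrow> b \<le> P e + k"
  shows "\<exists>L. linear L \<and> (\<forall>x. L x \<le> P x) \<and> (\<forall>(e, k)\<in>S. b \<le> L e + k)"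
proof -
  define S' where "S' = (\<lambda>z. (0, - b) + z) ` S"
  have "convex S'" "S' \<noteq> {}" unfolding S'_def using S convex_translation by auto
  moreover have "0 \<le> P e + k" if "(e, k) \<in> S'" for e k
    using that ge unfolding S'_def by fastforce
  ultimately obtain Q where Q: "sublinear Q" "\<And>x. Q x \<le> P x" "\<And>e k. (e, k) \<in> S' \<Longrightarrow> Q (- e) \<le> k"
    using sublinear_lower[OF P, of S'] by blast
  obtain L where L: "linear L" "\<And>x. L x \<le> Q x"
    using sublinear_dominates_linear[OF Q(1)] by auto
  have "b \<le> L e + k" if "(e, k) \<in> S" for e k
  proof -
    have "(e, k - b) \<in> S'" using that unfolding S'_def by (force simp: image_iff)
    then have "L (- e) \<le> k - b" using Q(3) L(2) order_trans by blast
    then show ?thesis using linear_neg[OF L(1), of e] by simp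
  qed
  then show ?thesis using L Q(2) order_trans by (intro exI[of _ L]) blast
qed

lemma sublinear_norm: "0 \<le> K \<Longrightarrow> sublinear (\<lambda>x::'e::real_normed_vector. K * norm x)"
  unfolding sublinear_def
  by (auto simp: distrib_left[symmetric] intro!: mult_left_mono norm_triangle_ineq)

corollary mazur_orlicz_normed:
  fixes S :: "('e::real_normed_vector \<times> real) set"
  assumes K: "0 \<le> K" and S: "convex S" "S \<noteq> {}"
    and ge: "\<And>e k. (e, k) \<in> S \<Longrightarrow> b \<le> K * norm e + k"
  shows "\<exists>L :: 'e \<Rightarrow>\<^sub>L real. \<forall>(e, k)\<in>S. b \<le> blinfun_apply L e + k"
proof -
  obtain L where L: "linear L" "\<And>x. L x \<le> K * norm x" "\<And>e k. (e, k) \<in> S \<Longrightarrow> b \<le> L e + k"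
    using mazur_orlicz[OF sublinear_norm[OF K] S ge] by blast
  have "norm (L x) \<le> norm x * K" for x
    using L(2)[of x] L(2)[of "- x"] linear_neg[OF L(1), of x] by (simp add: mult.commute)
  then have "bounded_linear L"
    using L(1) by (intro bounded_linear_intro[of L K]) (auto simp: linear_add linear_cmul)
  then show ?thesis
    using L(3) by (intro exI[of _ "Blinfun L"]) (auto simp: bounded_linear_Blinfun_apply)
qed

text \<open>A ball around a point of \<open>U\<close> on which \<open>V\<close> is bounded above
  yields a linear lower bound: s + t can drop below b by at most a multiple of the distance between
  the base points. This is the Mazur-Orlicz hypothesis for the set of differences, and L is the dual
  multiplier.\<close>

theorem fenchel_duality:
  fixes U V :: "('e::real_normed_vector \<times> real) set"
  assumes cU: "convex U" and cV: "convex V"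
    and z0: "(z0, a) \<in> U" and r: "r > 0"
    and int: "\<And>z. norm (z - z0) \<le> r \<Longrightarrow> (z, m) \<in> V"
    and ge: "\<And>z s t. (z, s) \<in> U \<Longrightarrow> (z, t) \<in> V \<Longrightarrow> b \<le> s + t"
  shows "\<exists>L :: 'e \<Rightarrow>\<^sub>L real. \<forall>(z1, s)\<in>U. \<forall>(z2, t)\<in>V. b \<le> s + t + blinfun_apply L (z1 - z2)"
proof -
  \<comment> \<open>Excess of the reference pair over b, divided by the radius of the ball: the
    slope for which the estimate below closes.\<close>
  define K where "K = (a + m - b) / r"
  have am: "b \<le> a + m" using ge z0 int[of z0] r by auto
  have K: "0 \<le> K" unfolding K_def using am r by simp
  define f where "f = (\<lambda>(w::('e \<times> real) \<times> ('e \<times> real)). (fst (fst w) - fst (snd w), snd (fst w) + snd (snd w)))"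
  define S where "S = f ` (U \<times> V)"
  have lin: "linear f"
    unfolding f_def by (intro linearI) (auto simp: algebra_simps)
  have S: "convex S" "S \<noteq> {}"
    unfolding S_def using cU cV z0 int[of z0] r
    by (auto intro!: convex_linear_image lin convex_Times)
  have "b \<le> K * norm e + k" if ek: "(e, k) \<in> S" for e k
  proof -
    obtain z1 s z2 t where w: "(z1, s) \<in> U" "(z2, t) \<in> V" "e = z1 - z2" "k = s + t"
      using ek unfolding S_def f_def by force
    show ?thesis
    proof (cases "e = 0")
      case True
      then show ?thesis using ge[of z1 s t] w by simp
    next
      case False
      define d where "d = norm e"
      have d: "d > 0" using False unfolding d_def by simp
      \<comment> \<open>The point y below lies at distance r from z0 in the direction e = z1 - z2.
        With weight \<tau>, moving z2 towards y and z1 towards z0 leads to the same point, where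
        \<open>ge\<close> applies.\<close>
      define \<tau> where "\<tau> = d / (d + r)"
      have \<tau>: "0 \<le> \<tau>" "\<tau> \<le> 1" "1 - \<tau> = r / (d + r)" using d r unfolding \<tau>_def by (auto simp: field_simps)
      define y where "y = z0 + (r / d) *\<^sub>R e"
      have "(y, m) \<in> V" using d r by (intro int) (auto simp: y_def d_def)
      then have 1: "(1 - \<tau>) *\<^sub>R (z2, t) + \<tau> *\<^sub>R (y, m) \<in> V"
        using convexD[OF cV w(2), of "(y,m)" "1 - \<tau>" \<tau>] \<tau> by simp
      have 2: "(1 - \<tau>) *\<^sub>R (z1, s) + \<tau> *\<^sub>R (z0, a) \<in> U"
        using convexD[OF cU w(1) z0, of "1 - \<tau>" \<tau>] \<tau> by simp
      have "\<tau> * (r / d) = 1 - \<tau>" unfolding \<tau>(3) using d r by (simp add: \<tau>_def)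
      then have "(1 - \<tau>) *\<^sub>R z2 + \<tau> *\<^sub>R y = (1 - \<tau>) *\<^sub>R z1 + \<tau> *\<^sub>R z0"
        unfolding y_def w(3) by (simp only: scaleR_add_right scaleR_scaleR) (simp add: algebra_simps)
      then have "b \<le> ((1 - \<tau>) * s + \<tau> * a) + ((1 - \<tau>) * t + \<tau> * m)"
        using ge[of "(1 - \<tau>) *\<^sub>R z1 + \<tau> *\<^sub>R z0"] 1 2 by simp
      then have "b \<le> (1 - \<tau>) * k + \<tau> * (a + m)" unfolding w(4) by (simp add: algebra_simps)
      then have "b \<le> (r * k + d * (a + m)) / (d + r)"
        unfolding \<tau>(3) unfolding \<tau>_def by (simp add: add_divide_distrib)
      then have "b * (d + r) \<le> r * k + d * (a + m)"
        using d r by (simp add: pos_le_divide_eq)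
      then show ?thesis unfolding K_def d_def[symmetric] using r by (simp add: field_simps)
    qed
  qed
  then obtain L :: "'e \<Rightarrow>\<^sub>L real" where L: "\<And>e k. (e, k) \<in> S \<Longrightarrow> b \<le> blinfun_apply L e + k"
    using mazur_orlicz_normed[OF K S, of b] by blast
  have "b \<le> s + t + blinfun_apply L (z1 - z2)" if "(z1, s) \<in> U" "(z2, t) \<in> V" for z1 s z2 t
  proof -
    have "(z1 - z2, s + t) \<in> S" unfolding S_def f_def using that by force
    from L[OF this] show ?thesis by simp
  qed
  then show ?thesis by (intro exI[of _ L]) blast
qed

section \<open>Strong representative functions and type (D)\<close>

text \<open>Real numbers s above h absorb the infinite values: at +infinity there is no such s, at
  -infinity all of them occur and both sides fail.\<close>

lemma fconj_le_iff:
  "fconj h (u, w) \<le> ereal m \<longleftrightarrow>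
    (\<forall>x v s. h (x, v) \<le> ereal s \<longrightarrow> blinfun_apply u x + blinfun_apply w v - s \<le> m)"
proof -
  have "ereal c - y \<le> ereal m \<longleftrightarrow> (\<forall>s. y \<le> ereal s \<longrightarrow> c - s \<le> m)" for c and y :: ereal
  proof (cases y)
    case (real r)
    then show ?thesis by (auto simp: algebra_simps intro: order_trans)
  next
    case MInf
    then show ?thesis by (auto intro!: exI[of _ "c - m - 1"])
  qed auto
  then show ?thesis
    unfolding fconj_def by (auto simp: SUP_le_iff)
qed

lemma strong_representative_convex: "strong_representative h G \<Longrightarrow> convex (epigraph h)"
  unfolding strong_representative_def representative_def ereal_convex_def by simp

lemma strong_representative_closed: "strong_representative h G \<Longrightarrow> closed (epigraph h)"
  unfolding strong_representative_def representative_def ereal_lsc_def by simp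

lemma strong_representative_ge:
  "strong_representative h G \<Longrightarrow> h (x, v) \<le> ereal s \<Longrightarrow> blinfun_apply v x \<le> s"
  unfolding strong_representative_def representative_def coupling_def
  by (metis ereal_less_eq(3) fst_conv order_trans snd_conv)

lemma strong_representative_conj_ge:
  assumes "strong_representative h G"
    and "\<And>x v s. h (x, v) \<le> ereal s \<Longrightarrow> blinfun_apply p x + blinfun_apply q v - s \<le> m"
  shows "blinfun_apply q p \<le> m"
proof -
  have "fconj h (p, q) \<le> ereal m" using assms(2) fconj_le_iff by blast
  then show ?thesis
    using assms(1) unfolding strong_representative_def by (metis ereal_less_eq(3) order_trans)
qed

lemma blinfun_prod_split:
  fixes L :: "('a::real_normed_vector \<times> 'b::real_normed_vector) \<Rightarrow>\<^sub>L real"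
  obtains p q where "\<And>x v. blinfun_apply L (x, v) = blinfun_apply p x + blinfun_apply q v"
proof
  have 1: "bounded_linear (\<lambda>x::'a. (x, 0::'b))" "bounded_linear (\<lambda>v::'b. (0::'a, v))"
    by (auto intro!: bounded_linear_Pair bounded_linear_ident bounded_linear_zero)
  show "blinfun_apply L (x, v) = blinfun_apply (L o\<^sub>L Blinfun (\<lambda>x. (x, 0))) x + blinfun_apply (L o\<^sub>L Blinfun (\<lambda>v. (0, v))) v" for x v
    using blinfun.add_right[of L "(x, 0)" "(0, v)"] 1
    by (simp add: bounded_linear_Blinfun_apply)
qed

lemma norm_PairD:
  assumes "norm (a, b) \<le> r" shows "norm a \<le> r" "norm b \<le> r"
  using assms norm_fst_le[of a b] norm_snd_le[of b a] by linarith+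

lemma blinfun_le_norm: "blinfun_apply (f :: 'a::real_normed_vector \<Rightarrow>\<^sub>L real) x \<le> norm f * norm x"
  using norm_blinfun[of f x] by simp

lemma blinfun_norm_exceeds:
  fixes f :: "'a::real_normed_vector \<Rightarrow>\<^sub>L real"
  assumes "k < norm f" "0 \<le> k"
  obtains y where "k * norm y < blinfun_apply f y"
proof -
  have "\<exists>y. \<not> norm (blinfun_apply f y) \<le> k * norm y"
    using norm_blinfun_bound[OF assms(2), of f] assms(1) by force
  then obtain y where "k * norm y < \<bar>blinfun_apply f y\<bar>"
    by (auto simp: not_le)
  then have "k * norm y < blinfun_apply f y \<or> k * norm (- y) < blinfun_apply f (- y)"
    by (auto simp: blinfun.minus_right abs_if split: if_splits)
  then show ?thesis using that by blast
qed

text \<open>Fenchel duality for the sum of h and f \<oplus> f*(- \<cdot>), where f is k times the distance to C minus u.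
  The conjugate of f at -v is the support function of C at u - v, restricted to |u - v| \<le> k.\<close>
lemma strong_representative_penalty:
  fixes h :: "'a::real_normed_vector \<times> 'a dual \<Rightarrow> ereal"
  assumes h: "strong_representative h G"
    and C: "convex C" "C \<noteq> {}" "\<And>c. c \<in> C \<Longrightarrow> norm c \<le> B"
    and dom: "h (x0, v0) \<le> ereal s0" and k: "norm (u - v0) < k" and e: "0 < e"
  obtains x v s c where "h (x, v) \<le> ereal s" "norm (u - v) \<le> k" "c \<in> C"
    "\<And>c'. c' \<in> C \<Longrightarrow> s + k * norm (x - c) - blinfun_apply u x + blinfun_apply (u - v) c' < e"
proof (rule ccontr)
  assume "\<not> thesis"
  note neg = this and witness = that
  have k0: "0 < k" using k norm_ge_zero[of "u - v0"] by linarith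
  \<comment> \<open>\<open>V\<close> plays the role of the epigraph of the penalty. A witness c
    replaces the infimum in d(x, C), which need not be attained, and the bound over all c' replaces
    the support function.\<close>
  define V where "V = {((x, v), t). norm (u - v) \<le> k \<and>
    (\<exists>c\<in>C. \<forall>c'\<in>C. k * norm (x - c) - blinfun_apply u x + blinfun_apply (u - v) c' \<le> t)}"
  have cV: "convex V"
  proof (rule convexI)
    fix z1 z2 and a b :: real
    assume z: "z1 \<in> V" "z2 \<in> V" and ab: "0 \<le> a" "0 \<le> b" "a + b = 1"
    obtain x1 v1 t1 c1 where 1: "z1 = ((x1, v1), t1)" "norm (u - v1) \<le> k" "c1 \<in> C"
      "\<And>c'. c' \<in> C \<Longrightarrow> k * norm (x1 - c1) - blinfun_apply u x1 + blinfun_apply (u - v1) c' \<le> t1"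
      using z(1) unfolding V_def by blast
    obtain x2 v2 t2 c2 where 2: "z2 = ((x2, v2), t2)" "norm (u - v2) \<le> k" "c2 \<in> C"
      "\<And>c'. c' \<in> C \<Longrightarrow> k * norm (x2 - c2) - blinfun_apply u x2 + blinfun_apply (u - v2) c' \<le> t2"
      using z(2) unfolding V_def by blast
    define x where "x = a *\<^sub>R x1 + b *\<^sub>R x2"
    define v where "v = a *\<^sub>R v1 + b *\<^sub>R v2"
    define c where "c = a *\<^sub>R c1 + b *\<^sub>R c2"
    have uv: "u - v = a *\<^sub>R (u - v1) + b *\<^sub>R (u - v2)"
      unfolding v_def using ab(3) by (simp add: algebra_simps flip: scaleR_add_left)
    have "norm (u - v) \<le> a * norm (u - v1) + b * norm (u - v2)"
      unfolding uv using norm_triangle_ineq[of "a *\<^sub>R (u - v1)" "b *\<^sub>R (u - v2)"] ab by simp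
    also have "\<dots> \<le> a * k + b * k" using 1 2 ab by (intro add_mono mult_left_mono) auto
    also have "\<dots> = k" using ab(3) by (simp flip: distrib_right)
    finally have nuv: "norm (u - v) \<le> k" .
    have cC: "c \<in> C" unfolding c_def using C(1) 1 2 ab by (simp add: convexD)
    have "norm (x - c) \<le> a * norm (x1 - c1) + b * norm (x2 - c2)"
    proof -
      have "x - c = a *\<^sub>R (x1 - c1) + b *\<^sub>R (x2 - c2)" unfolding x_def c_def by (simp add: algebra_simps)
      then show ?thesis using norm_triangle_ineq[of "a *\<^sub>R (x1 - c1)" "b *\<^sub>R (x2 - c2)"] ab by simp
    qed
    then have nx: "k * norm (x - c) \<le> k * (a * norm (x1 - c1) + b * norm (x2 - c2))"
      using k0 by (intro mult_left_mono) auto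
    have "k * norm (x - c) - blinfun_apply u x + blinfun_apply (u - v) c' \<le> a * t1 + b * t2" if c': "c' \<in> C" for c'
    proof -
      have "a * (k * norm (x1 - c1) - blinfun_apply u x1 + blinfun_apply (u - v1) c')
          + b * (k * norm (x2 - c2) - blinfun_apply u x2 + blinfun_apply (u - v2) c') \<le> a * t1 + b * t2"
        using 1(4)[OF c'] 2(4)[OF c'] ab by (intro add_mono mult_left_mono) auto
      moreover have "blinfun_apply (u - v) c' = a * blinfun_apply (u - v1) c' + b * blinfun_apply (u - v2) c'"
        unfolding uv by (simp add: blinfun.add_left blinfun.scaleR_left)
      moreover have "blinfun_apply u x = a * blinfun_apply u x1 + b * blinfun_apply u x2"
        unfolding x_def by (simp add: blinfun.add_right blinfun.scaleR_right)
      ultimately show ?thesis using nx by (simp add: algebra_simps)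
    qed
    then have "((x, v), a * t1 + b * t2) \<in> V" unfolding V_def using nuv cC by auto
    then show "a *\<^sub>R z1 + b *\<^sub>R z2 \<in> V" unfolding 1(1) 2(1) x_def v_def by simp
  qed
  \<comment> \<open>The strict inequality |u - v0| < k leaves this radius around (x0, v0), on which
    the cutoff holds and the penalty is bounded by \<open>m\<close>.\<close>
  define r where "r = (k - norm (u - v0))"
  have r: "r > 0" unfolding r_def using k by simp
  obtain c0 where c0: "c0 \<in> C" using C(2) by auto
  define m where "m = k * (norm x0 + r + B) + norm u * (norm x0 + r) + k * B"
  have int: "(z, m) \<in> V" if z: "norm (z - (x0, v0)) \<le> r" for z
  proof -
    obtain x v where zxv: "z = (x, v)" by fastforce
    have nx: "norm (x - x0) \<le> r" and nv: "norm (v - v0) \<le> r"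
      using norm_PairD[of "x - x0" "v - v0" r] z zxv by auto
    have "norm (u - v) \<le> norm (u - v0) + norm (v - v0)"
      using norm_triangle_ineq4[of "u - v0" "v - v0"] by simp
    then have uv: "norm (u - v) \<le> k" using nv unfolding r_def by simp
    have nx': "norm x \<le> norm x0 + r" using norm_triangle_ineq[of "x - x0" x0] nx by simp
    have "k * norm (x - c0) - blinfun_apply u x + blinfun_apply (u - v) c' \<le> m" if c': "c' \<in> C" for c'
    proof -
      have "norm (x - c0) \<le> norm x0 + r + B"
        using norm_triangle_ineq4[of x c0] nx' C(3)[OF c0] by simp
      then have 1: "k * norm (x - c0) \<le> k * (norm x0 + r + B)" using k0 by (intro mult_left_mono) auto
      have "- blinfun_apply u x \<le> norm u * norm x"
        using blinfun_le_norm[of u "- x"] by (simp add: blinfun.minus_right)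
      also have "\<dots> \<le> norm u * (norm x0 + r)" using nx' by (intro mult_left_mono) auto
      finally have 2: "- blinfun_apply u x \<le> norm u * (norm x0 + r)" .
      have "blinfun_apply (u - v) c' \<le> norm (u - v) * norm c'" by (rule blinfun_le_norm)
      also have "\<dots> \<le> k * B" using uv C(3)[OF c'] k0 by (intro mult_mono) auto
      finally show ?thesis using 1 2 unfolding m_def by simp
    qed
    then show ?thesis unfolding V_def zxv using uv c0 by auto
  qed
  have ge: "e \<le> s + t" if st: "(z, s) \<in> epigraph h" "(z, t) \<in> V" for z s t
  proof (rule ccontr)
    assume lt: "\<not> e \<le> s + t"
    obtain x v c where "z = (x, v)" "norm (u - v) \<le> k" "c \<in> C"
      "\<And>c'. c' \<in> C \<Longrightarrow> k * norm (x - c) - blinfun_apply u x + blinfun_apply (u - v) c' \<le> t"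
      using st(2) unfolding V_def by blast
    moreover have "h z \<le> ereal s" using st(1) unfolding epigraph_def by simp
    ultimately show False using neg witness[of x v s c] lt by force
  qed
  have z0: "((x0, v0), s0) \<in> epigraph h" unfolding epigraph_def using dom by simp
  have "\<exists>L :: ('a \<times> 'a dual) \<Rightarrow>\<^sub>L real. \<forall>(z1, s)\<in>epigraph h. \<forall>(z2, t)\<in>V.
      e \<le> s + t + blinfun_apply L (z1 - z2)"
    by (rule fenchel_duality[OF strong_representative_convex[OF h] cV z0 r]) (fact int, fact ge)
  then obtain L :: "('a \<times> 'a dual) \<Rightarrow>\<^sub>L real" where
    L: "\<And>z1 s z2 t. (z1, s) \<in> epigraph h \<Longrightarrow> (z2, t) \<in> V \<Longrightarrow> e \<le> s + t + blinfun_apply L (z1 - z2)"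
    by blast
  obtain p' q' where pq': "\<And>x v. blinfun_apply L (x, v) = blinfun_apply p' x + blinfun_apply q' v"
    using blinfun_prod_split by blast
  define p where "p = - p'"
  define q where "q = - q'"
  have Lz: "blinfun_apply L (x, v) = - blinfun_apply p x - blinfun_apply q v" for x v
    unfolding p_def q_def pq' by (simp add: blinfun.minus_left)
  \<comment> \<open>The supremum over the epigraph of h turns the separation into a bound by the
    conjugate at (p, q); replacing the conjugate by the smaller q p leaves an inequality about the
    penalty alone.\<close>
  have key: "e + blinfun_apply q p \<le> t + blinfun_apply p x + blinfun_apply q v" if V: "((x, v), t) \<in> V" for x v t
  proof -
    have "blinfun_apply q p \<le> t + blinfun_apply p x + blinfun_apply q v - e"
    proof (rule strong_representative_conj_ge[OF h])
      fix x1 v1 s assume "h (x1, v1) \<le> ereal s"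
      then have "((x1, v1), s) \<in> epigraph h" unfolding epigraph_def by simp
      from L[OF this V] show "blinfun_apply p x1 + blinfun_apply q v1 - s \<le> t + blinfun_apply p x + blinfun_apply q v - e"
        by (simp add: Lz blinfun.diff_right algebra_simps)
    qed
    then show ?thesis by simp
  qed
  show False
  proof (cases "norm (u - p) \<le> k")
    case True
    have bdd: "bdd_above (blinfun_apply (u - p) ` C)"
    proof (rule bdd_aboveI2)
      fix c assume c: "c \<in> C"
      have "blinfun_apply (u - p) c \<le> norm (u - p) * norm c" by (rule blinfun_le_norm)
      also have "\<dots> \<le> norm (u - p) * B" using C(3)[OF c] by (intro mult_left_mono) auto
      finally show "blinfun_apply (u - p) c \<le> norm (u - p) * B" .
    qed
    define \<sigma> where "\<sigma> = (SUP c\<in>C. blinfun_apply (u - p) c)"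
    have up: "blinfun_apply (u - p) c' \<le> \<sigma>" if "c' \<in> C" for c'
      unfolding \<sigma>_def by (rule cSUP_upper[OF that bdd])
    have "\<exists>c\<in>C. \<sigma> - e / 2 < blinfun_apply (u - p) c"
      using less_cSUP_iff[OF C(2) bdd, of "\<sigma> - e / 2"] e unfolding \<sigma>_def by simp
    then obtain c where c: "c \<in> C" "\<sigma> - e / 2 < blinfun_apply (u - p) c" by auto
    \<comment> \<open>With v = p the bidual functional q stands on both sides of \<open>key\<close>
      and cancels. As c nearly attains \<sigma>, the rest reads e \<le> e / 2.\<close>
    have "((c, p), - blinfun_apply u c + blinfun_apply (u - p) c + e / 2) \<in> V"
      unfolding V_def using True c up by (auto intro!: bexI[OF _ c(1)]) (smt (verit) field_sum_of_halves up)
    from key[OF this] show False using e by (simp add: blinfun.diff_left)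
  next
    case False
    then obtain y where y: "k * norm y < blinfun_apply (u - p) y"
      using blinfun_norm_exceeds[of k "u - p"] k0 by auto
    define d where "d = blinfun_apply (u - p) y - k * norm y"
    have d: "d > 0" unfolding d_def using y by simp
    \<comment> \<open>Going from c0 along y costs k |y| per unit and gains (u - p) y, which is more
      by d. This l makes the gain outweigh the fixed terms; v = u removes the support term.\<close>
    define l where "l = max 0 ((blinfun_apply p c0 - blinfun_apply u c0 + blinfun_apply q u - blinfun_apply q p) / d)"
    have l: "0 \<le> l" "(blinfun_apply p c0 - blinfun_apply u c0 + blinfun_apply q u - blinfun_apply q p) \<le> l * d"
      using d unfolding l_def by (auto simp: field_simps max_def)
    have "((c0 + l *\<^sub>R y, u), k * (l * norm y) - blinfun_apply u (c0 + l *\<^sub>R y)) \<in> V"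
      unfolding V_def using k0 l c0 by (auto intro!: bexI[OF _ c0])
    from key[OF this] l show False using e unfolding d_def
      by (simp add: blinfun.diff_left blinfun.add_right blinfun.scaleR_right algebra_simps)
  qed
qed

lemma bidual_emb_apply [simp]: "blinfun_apply (bidual_emb x) f = blinfun_apply f x"
  unfolding bidual_emb_def by (simp add: bounded_linear_Blinfun_apply)

section \<open>Bronsted-Rockafellar approximation of almost contact points\<close>

text \<open>The penalty with C = {x0} and u = v0 reduces the gap from k^2 to (k / 2)^2 and keeps |v
  - v0| \<le> k. The bound on x comes from h \<ge> c at the midpoint with (x0, v0): it controls - D
  / 2, and with - D \<le> k n this gives n \<le> 5 k / 2, rounded up to 3 k.\<close>

lemma strong_representative_step:
  fixes h :: "'a::real_normed_vector \<times> 'a dual \<Rightarrow> ereal"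
  assumes h: "strong_representative h G" and k: "0 < k"
    and z0: "h (x0, v0) \<le> ereal (blinfun_apply v0 x0 + k\<^sup>2)"
  obtains x v where "h (x, v) \<le> ereal (blinfun_apply v x + (k / 2)\<^sup>2)"
    "norm (v - v0) \<le> k" "norm (x - x0) \<le> 3 * k"
proof -
  obtain x v s where s: "h (x, v) \<le> ereal s" and nv: "norm (v0 - v) \<le> k"
    and le: "s + k * norm (x - x0) - blinfun_apply v0 x + blinfun_apply (v0 - v) x0 < (k / 2)\<^sup>2"
    by (rule strong_representative_penalty[OF h, of "{x0}" "norm x0" x0 v0 _ v0 k "(k / 2)\<^sup>2", OF _ _ _ z0])
      (use k in auto)
  define n where "n = norm (x - x0)"
  define D where "D = blinfun_apply (v - v0) (x - x0)"
  have "- D \<le> norm (v0 - v) * n"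
    using blinfun_le_norm[of "v0 - v" "x - x0"] unfolding D_def n_def by (simp add: blinfun.diff_left)
  also have "\<dots> \<le> k * n" using nv unfolding n_def by (intro mult_right_mono) auto
  finally have D: "- D \<le> k * n" .
  have le': "s - blinfun_apply v x + k * n + D < (k / 2)\<^sup>2"
    using le unfolding n_def D_def by (simp add: blinfun.diff_left blinfun.diff_right)
  have "(1/2::real) *\<^sub>R ((x, v), s) + (1/2::real) *\<^sub>R ((x0, v0), blinfun_apply v0 x0 + k\<^sup>2) \<in> epigraph h"
    using s z0 by (intro convexD[OF strong_representative_convex[OF h]]) (auto simp: epigraph_def)
  then have "h ((1/2) *\<^sub>R x + (1/2) *\<^sub>R x0, (1/2) *\<^sub>R v + (1/2) *\<^sub>R v0) \<le> ereal ((s + (blinfun_apply v0 x0 + k\<^sup>2)) / 2)"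
    unfolding epigraph_def by (simp add: add_divide_distrib)
  from strong_representative_ge[OF h this]
  have "blinfun_apply v x + blinfun_apply v0 x0 - D / 2 \<le> s + blinfun_apply v0 x0 + k\<^sup>2"
    unfolding D_def
    by (simp add: blinfun.add_left blinfun.add_right blinfun.scaleR_left blinfun.scaleR_right
        blinfun.diff_left blinfun.diff_right field_simps)
  moreover have "(k / 2)\<^sup>2 = k\<^sup>2 / 4" by (simp add: power_divide)
  ultimately have "k * n \<le> 3 * k\<^sup>2"
    using le' D zero_le_power2[of k] by linarith
  then have "k * n \<le> k * (3 * k)" by (simp add: power2_eq_square)
  then have "n \<le> 3 * k" using k by simp
  moreover have "s \<le> blinfun_apply v x + (k / 2)\<^sup>2" using le' D by linarith
  then have "h (x, v) \<le> ereal (blinfun_apply v x + (k / 2)\<^sup>2)"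
    using s by (meson ereal_less_eq(3) order_trans)
  ultimately show thesis using that nv unfolding n_def by (metis norm_minus_commute)
qed

text \<open>The iterated step is Cauchy: the n-th move is at most (3 + 1) k / 2^n in the product
  norm, and these sum to 8 k. Closedness of the epigraph carries the vanishing gaps to a contact
  point in the limit.\<close>

lemma strong_representative_bronsted_rockafellar:
  fixes h :: "'a::banach \<times> 'a dual \<Rightarrow> ereal"
  assumes h: "strong_representative h G" and k: "0 < k"
    and z0: "h (x0, v0) \<le> ereal (blinfun_apply v0 x0 + k\<^sup>2)"
  obtains x v where "h (x, v) \<le> ereal (blinfun_apply v x)"
    "norm (x - x0) \<le> 8 * k" "norm (v - v0) \<le> 8 * k"
proof -
  \<comment> \<open>The conjunct for n = 0 pins the start of the sequence, since dependent choice
    only promises some initial element.\<close>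
  define P where "P = (\<lambda>n z. h z \<le> ereal (blinfun_apply (snd z) (fst z) + (k / 2 ^ n)\<^sup>2) \<and> (n = 0 \<longrightarrow> z = (x0, v0)))"
  have "\<exists>f. \<forall>n. P n (f n) \<and> norm (f (Suc n) - f n) \<le> 4 * (k / 2 ^ n)"
  proof (rule dependent_nat_choice)
    show "\<exists>z. P 0 z" unfolding P_def using z0 by auto
  next
    fix z n assume P: "P n z"
    obtain x1 v1 where z: "z = (x1, v1)" by fastforce
    obtain x v where xv: "h (x, v) \<le> ereal (blinfun_apply v x + (k / 2 ^ n / 2)\<^sup>2)"
      "norm (v - v1) \<le> k / 2 ^ n" "norm (x - x1) \<le> 3 * (k / 2 ^ n)"
      using strong_representative_step[OF h, of "k / 2 ^ n" x1 v1] P k unfolding P_def z by auto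
    have "norm ((x, v) - z) \<le> 4 * (k / 2 ^ n)"
      unfolding z using norm_Pair_le[of "x - x1" "v - v1"] xv by simp
    then show "\<exists>z'. P (Suc n) z' \<and> norm (z' - z) \<le> 4 * (k / 2 ^ n)"
      unfolding P_def using xv(1) by (intro exI[of _ "(x, v)"]) (simp add: mult.commute)
  qed
  then obtain f where f: "\<And>n. P n (f n)" "\<And>n. norm (f (Suc n) - f n) \<le> 4 * (k / 2 ^ n)" by blast
  have geo: "(\<lambda>n. 4 * (k / 2 ^ n)) sums (8 * k)"
  proof -
    have "(\<lambda>n. 4 * k * (1 / 2) ^ n) sums (4 * k * (1 / (1 - 1 / 2)))"
      by (intro sums_mult geometric_sums) simp
    then show ?thesis by (simp add: power_one_over)
  qed
  have sn: "summable (\<lambda>n. norm (f (Suc n) - f n))"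
    by (rule summable_comparison_test'[OF sums_summable[OF geo]]) (use f(2) in auto)
  then have sm: "summable (\<lambda>n. f (Suc n) - f n)" by (rule summable_norm_cancel)
  define z where "z = f 0 + (\<Sum>n. f (Suc n) - f n)"
  have "(\<lambda>n. f 0 + (\<Sum>i<n. f (Suc i) - f i)) \<longlonglongrightarrow> z"
    unfolding z_def by (intro tendsto_intros summable_LIMSEQ sm)
  then have lim: "f \<longlonglongrightarrow> z"
    by (simp add: sum_lessThan_telescope)
  have "norm (z - f 0) \<le> (\<Sum>n. norm (f (Suc n) - f n))"
    unfolding z_def using summable_norm[OF sn] by simp
  also have "\<dots> \<le> (\<Sum>n. 4 * (k / 2 ^ n))"
    by (rule suminf_le[OF f(2) sn sums_summable[OF geo]])
  also have "\<dots> = 8 * k" using sums_unique[OF geo] by simp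
  finally have nz: "norm (z - (x0, v0)) \<le> 8 * k" using f(1)[of 0] unfolding P_def by simp
  have "(\<lambda>n. (k / 2 ^ n)\<^sup>2) \<longlonglongrightarrow> 0"
  proof -
    have "(\<lambda>n. k * (1 / 2) ^ n) \<longlonglongrightarrow> k * 0"
      by (intro tendsto_intros LIMSEQ_power_zero) simp
    then have "(\<lambda>n. (k / 2 ^ n)) \<longlonglongrightarrow> 0" by (simp add: power_one_over)
    from tendsto_power[OF this, of 2] show ?thesis by simp
  qed
  then have conv: "(\<lambda>n. (f n, blinfun_apply (snd (f n)) (fst (f n)) + (k / 2 ^ n)\<^sup>2))
      \<longlonglongrightarrow> (z, blinfun_apply (snd z) (fst z) + 0)"
    by (intro tendsto_intros lim)
  have "\<forall>n. (f n, blinfun_apply (snd (f n)) (fst (f n)) + (k / 2 ^ n)\<^sup>2) \<in> epigraph h"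
    using f(1) unfolding P_def epigraph_def by blast
  then have "(z, blinfun_apply (snd z) (fst z) + 0) \<in> epigraph h"
    using closed_sequentially[OF strong_representative_closed[OF h] _ conv] by blast
  moreover obtain x v where "z = (x, v)" by fastforce
  ultimately show thesis
    using that[of x v] nz norm_PairD[of "x - x0" "v - v0" "8 * k"] by (simp add: epigraph_def)
qed

text \<open>The hypothesis on C says that its support function dominates that of the ball of radius r around w.
  It forces the penalty term to be small together with |u - v|.\<close>
lemma strong_representative_approx:
  fixes h :: "'a::banach \<times> 'a dual \<Rightarrow> ereal" and w :: "'a bidual"
  assumes h: "strong_representative h G"
    and rel: "\<And>x v. h (x, v) \<le> ereal (blinfun_apply v x) \<Longrightarrow> 0 \<le> blinfun_apply (w - bidual_emb x) (u - v)"
    and dom: "h (x0, v0) \<le> ereal s0"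
    and C: "convex C" "C \<noteq> {}" "\<And>c. c \<in> C \<Longrightarrow> norm c \<le> B"
    and r: "0 < r"
    and supp: "\<And>p m. (\<And>c. c \<in> C \<Longrightarrow> blinfun_apply p c \<le> m) \<Longrightarrow> blinfun_apply w p + r * norm p \<le> m"
    and e: "0 < e"
  obtains x v c where "h (x, v) \<le> ereal (blinfun_apply v x)" "c \<in> C" "norm (x - c) < e" "norm (v - u) < e"
proof -
  define k where "k = norm (u - v0) + 1"
  have k: "1 \<le> k" unfolding k_def by simp
  obtain c0 where "c0 \<in> C" using C(2) by auto
  then have B: "0 \<le> B" using C(3) norm_ge_zero order_trans by blast
  \<comment> \<open>\<open>N\<close> collects coefficients of \<theta> in the final estimate.
    \<open>q1\<close> and \<open>q2\<close> will bound |x' - c| / \<theta> and |v' - u| / \<theta>,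
    each with an extra 1 for the Bronsted-Rockafellar correction.\<close>
  define N where "N = k + B + 1 + norm w"
  have N: "0 < N" unfolding N_def using k B norm_ge_zero[of w] by linarith
  define q1 q2 where "q1 = 2 * (1 + N) + 1" and "q2 = (1 + N) / r + 1"
  have q: "0 < q1" "0 < q2" unfolding q1_def q2_def using N r by (auto intro!: add_pos_pos)
  \<comment> \<open>\<theta> \<le> 1 / 2 lets \<theta> n be absorbed into k n, as k \<ge> 1. The
    penalty is run with gap (\<theta> / 8)^2 because the approximation moves points by eight times
    the root of the gap.\<close>
  define \<theta> where "\<theta> = min (1 / 2) (min (e / (2 * q1)) (e / (2 * q2)))"
  have \<theta>: "0 < \<theta>" "\<theta> \<le> 1 / 2" "\<theta> \<le> e / (2 * q1)" "\<theta> \<le> e / (2 * q2)"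
    unfolding \<theta>_def using q e by auto
  have "\<theta> * q1 < e" "\<theta> * q2 < e"
    using \<theta>(3,4) q e by (auto simp: pos_le_divide_eq)
  then have \<theta>1: "\<theta> * (2 * (1 + N) + 1) < e" and \<theta>2: "\<theta> * ((1 + N) / r + 1) < e"
    unfolding q1_def q2_def by auto
  have uk: "norm (u - v0) < k" unfolding k_def by simp
  have e': "0 < (\<theta> / 8)\<^sup>2" using \<theta>(1) by simp
  obtain x v s c where s: "h (x, v) \<le> ereal s" and uv: "norm (u - v) \<le> k" and c: "c \<in> C"
    and pen: "\<And>c'. c' \<in> C \<Longrightarrow> s + k * norm (x - c) - blinfun_apply u x + blinfun_apply (u - v) c' < (\<theta> / 8)\<^sup>2"
    by (rule strong_representative_penalty[OF h C(1,2) _ dom uk e']) (rule C(3), assumption, blast)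
  define n where "n = norm (x - c)"
  have "blinfun_apply (u - v) (x - c) \<le> norm (u - v) * n"
    unfolding n_def by (rule blinfun_le_norm)
  also have "\<dots> \<le> k * n" using uv unfolding n_def by (intro mult_right_mono) auto
  finally have "s \<le> blinfun_apply v x + (\<theta> / 8)\<^sup>2"
    using pen[OF c] unfolding n_def by (simp add: blinfun.diff_left blinfun.diff_right)
  then have "h (x, v) \<le> ereal (blinfun_apply v x + (\<theta> / 8)\<^sup>2)"
    using s by (meson ereal_less_eq(3) order_trans)
  then obtain x' v' where M: "h (x', v') \<le> ereal (blinfun_apply v' x')"
    and d: "norm (x' - x) \<le> \<theta>" "norm (v' - v) \<le> \<theta>"
    using strong_representative_bronsted_rockafellar[OF h, of "\<theta> / 8" x v] \<theta>(1) by auto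
  \<comment> \<open>\<open>supp\<close> at p = u - v trades the bound over C for the value at w plus
    r |u - v|; the extra term is what brings v close to u.\<close>
  have "blinfun_apply w (u - v) + r * norm (u - v) \<le> (\<theta> / 8)\<^sup>2 - s - k * n + blinfun_apply u x"
    by (rule supp) (use pen in \<open>fastforce simp: n_def\<close>)
  moreover have "blinfun_apply v x \<le> s" by (rule strong_representative_ge[OF h s])
  ultimately have 1: "r * norm (u - v) + k * n \<le> (\<theta> / 8)\<^sup>2 + (blinfun_apply (u - v) x - blinfun_apply w (u - v))"
    by (simp add: blinfun.diff_left)
  \<comment> \<open>Inserting the contact point (x', v') isolates the term that \<open>rel\<close>
    makes nonpositive; the other three are small since |x' - x| and |v' - v| are at most
    \<theta>.\<close>
  have "blinfun_apply (u - v) x - blinfun_apply w (u - v)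
      = - blinfun_apply (w - bidual_emb x') (u - v') + blinfun_apply (v' - v) x'
        + blinfun_apply (u - v) (x - x') + blinfun_apply w (v - v')"
    by (simp add: blinfun.diff_left blinfun.diff_right)
  moreover have "blinfun_apply (v' - v) x' \<le> \<theta> * norm x'"
    using blinfun_le_norm[of "v' - v" x'] mult_right_mono[OF d(2) norm_ge_zero[of x']] by linarith
  moreover have "blinfun_apply (u - v) (x - x') \<le> k * \<theta>"
    using blinfun_le_norm[of "u - v" "x - x'"] mult_mono[OF uv d(1)] k by (simp add: norm_minus_commute)
  moreover have "blinfun_apply w (v - v') \<le> norm w * \<theta>"
    using blinfun_le_norm[of w "v - v'"] mult_left_mono[OF d(2) norm_ge_zero[of w]] by (simp add: norm_minus_commute)
  ultimately have 2: "blinfun_apply (u - v) x - blinfun_apply w (u - v) \<le> \<theta> * norm x' + k * \<theta> + norm w * \<theta>"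
    using rel[OF M] by linarith
  have "norm x' \<le> norm (x' - x) + norm (x - c) + norm c"
    using norm_triangle_ineq[of "x' - x" x] norm_triangle_ineq[of "x - c" c] by simp
  then have "norm x' \<le> n + B + 1" using d(1) \<theta>(2) C(3)[OF c] unfolding n_def by linarith
  then have "\<theta> * norm x' \<le> \<theta> * (n + B + 1)" using \<theta>(1) by (intro mult_left_mono) auto
  then have 3: "r * norm (u - v) + k * n \<le> (\<theta> / 8)\<^sup>2 + \<theta> * n + \<theta> * N"
    using 1 2 unfolding N_def by (simp add: algebra_simps)
  have n0: "0 \<le> n" unfolding n_def by simp
  have "(\<theta> / 8)\<^sup>2 \<le> \<theta>"
  proof -
    have "\<theta> * \<theta> \<le> \<theta> * 1" using \<theta> by (intro mult_left_mono) auto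
    then show ?thesis using \<theta>(1) by (simp add: power2_eq_square)
  qed
  moreover have "\<theta> * n \<le> n / 2" using mult_right_mono[OF \<theta>(2) n0] by simp
  moreover have "n \<le> k * n" using mult_right_mono[OF k n0] by simp
  ultimately have 4: "r * norm (u - v) + n / 2 \<le> \<theta> * (1 + N)"
    using 3 by (simp add: algebra_simps)
  have "0 \<le> r * norm (u - v)" using r by simp
  then have "n \<le> \<theta> * (2 * (1 + N))" using 4 by (simp add: algebra_simps)
  moreover have "norm (x' - c) \<le> norm (x' - x) + n"
    unfolding n_def using norm_triangle_ineq[of "x' - x" "x - c"] by simp
  ultimately have xc: "norm (x' - c) < e" using \<theta>1 d(1) by (simp add: algebra_simps)
  have "r * norm (u - v) \<le> \<theta> * (1 + N)" using 4 n0 by simp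
  then have "norm (u - v) \<le> \<theta> * ((1 + N) / r)" using r by (simp add: field_simps)
  moreover have "norm (v' - u) \<le> norm (v' - v) + norm (u - v)"
    using norm_triangle_ineq4[of "v' - v" "u - v"] by simp
  ultimately have "norm (v' - u) < e" using \<theta>2 d(2) by (simp add: algebra_simps)
  then show thesis using that M c xc by blast
qed

section \<open>Weak-star tools: evaluation functionals, Goldstine's theorem, basic
  neighbourhoods\<close>

lemma norm_blinfun_le_if_ball:
  fixes f :: "'a::real_normed_vector \<Rightarrow>\<^sub>L real"
  assumes R: "0 \<le> R" and le: "\<And>x. norm x \<le> R \<Longrightarrow> blinfun_apply f x \<le> m"
  shows "R * norm f \<le> m"
proof (cases "R = 0")
  case True
  then show ?thesis using le[of 0] by simp
next
  case False
  with R have R: "0 < R" by simp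
  have m: "0 \<le> m" using le[of 0] R by simp
  have "norm (blinfun_apply f x) \<le> m / R * norm x" for x
  proof (cases "x = 0")
    case False
    have "blinfun_apply f ((R / norm x) *\<^sub>R x) \<le> m" "blinfun_apply f ((- R / norm x) *\<^sub>R x) \<le> m"
      using False R by (auto intro!: le)
    then have "R * blinfun_apply f x \<le> m * norm x" "- (R * blinfun_apply f x) \<le> m * norm x"
      using False by (auto simp: blinfun.scaleR_right blinfun.minus_right field_simps)
    then have "\<bar>R * blinfun_apply f x\<bar> \<le> m * norm x" by linarith
    then have "R * \<bar>blinfun_apply f x\<bar> \<le> m * norm x" using R by (simp add: abs_mult)
    then show ?thesis using R by (simp add: field_simps)
  qed simp
  then have "norm f \<le> m / R" using m R by (intro norm_blinfun_bound) auto
  then show ?thesis using R by (simp add: field_simps)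
qed

text \<open>If some g vanishes on F but not at y, subtracting L g / g y times the evaluation at y
  leaves a functional that vanishes on the annihilator of F; otherwise y is redundant.\<close>

lemma linear_functional_evaluation:
  fixes L :: "'a::real_normed_vector dual \<Rightarrow> real"
  assumes "finite F" "linear L" "\<And>f. (\<And>x. x \<in> F \<Longrightarrow> blinfun_apply f x = 0) \<Longrightarrow> L f = 0"
  shows "\<exists>x. \<forall>f. L f = blinfun_apply f x"
  using assms
proof (induction F arbitrary: L rule: finite_induct)
  case empty
  then show ?case by (intro exI[of _ 0]) auto
next
  case (insert y F)
  show ?case
  proof (cases "\<exists>g :: 'a dual. (\<forall>x\<in>F. blinfun_apply g x = 0) \<and> blinfun_apply g y \<noteq> 0")
    case True
    then obtain g :: "'a dual" where g: "\<And>x. x \<in> F \<Longrightarrow> blinfun_apply g x = 0" "blinfun_apply g y \<noteq> 0" by blast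
    define a where "a = L g / blinfun_apply g y"
    define L' where "L' f = L f - a * blinfun_apply f y" for f
    have "linear L'"
      unfolding L'_def using insert.prems(1)
      by (auto intro!: linearI simp: linear_add linear_cmul blinfun.add_left blinfun.scaleR_left algebra_simps)
    moreover have "L' f = 0" if f: "\<And>x. x \<in> F \<Longrightarrow> blinfun_apply f x = 0" for f
    proof -
      define b where "b = blinfun_apply f y / blinfun_apply g y"
      have "L (f - b *\<^sub>R g) = 0"
        using f g by (intro insert.prems(2)) (auto simp: b_def blinfun.diff_left blinfun.scaleR_left)
      then show ?thesis
        unfolding L'_def a_def using insert.prems(1) g(2)
        by (simp add: linear_diff linear_cmul b_def)
    qed
    ultimately obtain x where "\<And>f. L' f = blinfun_apply f x" using insert.IH by blast
    then have "L f = blinfun_apply f (x + a *\<^sub>R y)" for f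
      unfolding L'_def by (simp add: blinfun.add_right blinfun.scaleR_right algebra_simps)
    then show ?thesis by blast
  next
    case False
    then have "L f = 0" if "\<And>x. x \<in> F \<Longrightarrow> blinfun_apply f x = 0" for f
      using that by (intro insert.prems(2)) auto
    then show ?thesis using insert.IH insert.prems(1) by blast
  qed
qed

text \<open>Domination by finitely many evaluations forces L to vanish where they all do. Thus a
  functional obtained from \<open>mazur_orlicz\<close> with a weak-star seminorm becomes a point of
  the underlying space.\<close>

lemma linear_functional_evaluation_le:
  fixes L :: "'a::real_normed_vector dual \<Rightarrow> real"
  assumes F: "finite F" and L: "linear L" "\<And>f. L f \<le> (\<Sum>x\<in>F. \<bar>blinfun_apply f x\<bar>)"
  shows "\<exists>x. \<forall>f. L f = blinfun_apply f x"
proof (rule linear_functional_evaluation[OF F L(1)])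
  fix f :: "'a dual" assume f: "\<And>x. x \<in> F \<Longrightarrow> blinfun_apply f x = 0"
  have "L f \<le> 0" "L (- f) \<le> 0"
    using L(2)[of f] L(2)[of "- f"] f by (simp_all add: blinfun.minus_left)
  then show "L f = 0" using linear_neg[OF L(1), of f] by simp
qed

lemma sublinear_sum_abs:
  assumes "\<And>i. i \<in> F \<Longrightarrow> linear (g i)"
  shows "sublinear (\<lambda>z. \<Sum>i\<in>F. \<bar>g i z :: real\<bar>)"
  unfolding sublinear_def
proof (intro conjI allI impI)
  fix x y
  show "(\<Sum>i\<in>F. \<bar>g i (x + y)\<bar>) \<le> (\<Sum>i\<in>F. \<bar>g i x\<bar>) + (\<Sum>i\<in>F. \<bar>g i y\<bar>)"
    unfolding sum.distrib[symmetric] using assms by (intro sum_mono) (auto simp: linear_add)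
next
  fix c :: real and x assume "0 \<le> c"
  then show "(\<Sum>i\<in>F. \<bar>g i (c *\<^sub>R x)\<bar>) = c * (\<Sum>i\<in>F. \<bar>g i x\<bar>)"
    unfolding sum_distrib_left using assms by (intro sum.cong) (auto simp: linear_cmul abs_mult)
qed

text \<open>Otherwise the seminorm of the neighbourhood separates the ball from w, and the
  separating functional is evaluation at some g in the dual. This gives R |g| \<le> - w g -
  \<delta>, which contradicts |w| \<le> R.\<close>

theorem goldstine:
  fixes w :: "'a::real_normed_vector bidual"
  assumes F: "finite F" and w: "norm w \<le> R" and d: "0 < \<delta>"
  obtains x where "norm x \<le> R" "\<And>f. f \<in> F \<Longrightarrow> \<bar>blinfun_apply f x - blinfun_apply w f\<bar> \<le> \<delta>"
proof (rule ccontr)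
  note witness = that
  assume "\<not> thesis"
  then have neg: "\<exists>f\<in>F. \<delta> < \<bar>blinfun_apply f x - blinfun_apply w f\<bar>" if "norm x \<le> R" for x
    using witness[OF that] by (meson not_le)
  have R: "0 \<le> R" using w norm_ge_zero order_trans by blast
  define S where "S = (\<lambda>x. (bidual_emb x - w, 0::real)) ` cball 0 R"
  have lin: "linear (bidual_emb :: 'a \<Rightarrow> 'a bidual)"
    by (intro linearI blinfun_eqI) (auto simp: blinfun.add_left blinfun.add_right blinfun.scaleR_left blinfun.scaleR_right)
  have "S = (\<lambda>z. (- w, 0) + z) ` ((\<lambda>x. (bidual_emb x, 0)) ` cball 0 R)"
    unfolding S_def by (auto simp: image_image)
  moreover have "linear (\<lambda>x::'a. (bidual_emb x, 0::real))"
    using lin by (intro linearI) (auto simp: linear_add linear_cmul)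
  ultimately have S: "convex S" "S \<noteq> {}"
    using R by (auto simp: convex_translation convex_linear_image)
  define P where "P z = (\<Sum>f\<in>F. \<bar>blinfun_apply z f\<bar>)" for z :: "'a bidual"
  have P: "sublinear P"
    unfolding P_def by (rule sublinear_sum_abs) (auto intro!: linearI simp: blinfun.add_left blinfun.scaleR_left)
  have "\<delta> \<le> P e + k" if ek: "(e, k) \<in> S" for e k
  proof -
    obtain x where x: "norm x \<le> R" "e = bidual_emb x - w" "k = 0"
      using ek unfolding S_def by auto
    obtain f where f: "f \<in> F" "\<delta> < \<bar>blinfun_apply f x - blinfun_apply w f\<bar>" using neg[OF x(1)] by auto
    then have "\<delta> \<le> \<bar>blinfun_apply e f\<bar>" unfolding x(2) by (simp add: blinfun.diff_left)
    also have "\<dots> \<le> P e" unfolding P_def using F f(1) by (intro member_le_sum) auto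
    finally show ?thesis using x(3) by simp
  qed
  then obtain L where L: "linear L" "\<And>z. L z \<le> P z" "\<And>e k. (e, k) \<in> S \<Longrightarrow> \<delta> \<le> L e + k"
    using mazur_orlicz[OF P S, of \<delta>] by blast
  obtain g where g: "\<And>z. L z = blinfun_apply z g"
    using linear_functional_evaluation_le[OF F L(1)] L(2) unfolding P_def by blast
  have "blinfun_apply (- g) x \<le> - blinfun_apply w g - \<delta>" if "norm x \<le> R" for x
    using L(3)[of "bidual_emb x - w" 0] that unfolding S_def g by (auto simp: blinfun.diff_left blinfun.minus_left)
  from norm_blinfun_le_if_ball[OF R this]
  have "R * norm g \<le> - blinfun_apply w g - \<delta>" by simp
  moreover have "- blinfun_apply w g \<le> norm w * norm g"
    using blinfun_le_norm[of w "- g"] by (simp add: blinfun.minus_right)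
  moreover have "norm w * norm g \<le> R * norm g" using w by (intro mult_right_mono) auto
  ultimately show False using d by linarith
qed

lemma openin_wstar_basic:
  assumes U: "openin wstar U" and w: "w \<in> U"
  obtains F \<epsilon> where "finite F" "0 < \<epsilon>"
    "\<And>z. (\<And>f. f \<in> F \<Longrightarrow> \<bar>blinfun_apply z f - blinfun_apply w f\<bar> < \<epsilon>) \<Longrightarrow> z \<in> U"
proof -
  obtain V where V: "openin (product_topology (\<lambda>_. euclideanreal) UNIV) V" "U = blinfun_apply -` V"
    using U unfolding wstar_def openin_pullback_topology by auto
  obtain X where X: "blinfun_apply w \<in> Pi\<^sub>E UNIV X" "\<And>i. open (X i)" "finite {i. X i \<noteq> UNIV}" "Pi\<^sub>E UNIV X \<subseteq> V"
    using product_topology_open_contains_basis[OF V(1), of "blinfun_apply w"] w V(2) by auto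
  define F where "F = {i. X i \<noteq> UNIV}"
  have "\<exists>e>0. \<forall>y. \<bar>y - blinfun_apply w i\<bar> < e \<longrightarrow> y \<in> X i" for i
    using X(1) X(2)[of i, unfolded open_dist] by (auto simp: dist_real_def PiE_iff)
  then obtain e where e: "\<And>i. 0 < e i" "\<And>i y. \<bar>y - blinfun_apply w i\<bar> < e i \<Longrightarrow> y \<in> X i" by metis
  define \<epsilon> where "\<epsilon> = Min (insert 1 (e ` F))"
  have F: "finite F" unfolding F_def by (rule X(3))
  have \<epsilon>: "0 < \<epsilon>" "\<And>i. i \<in> F \<Longrightarrow> \<epsilon> \<le> e i" unfolding \<epsilon>_def using F e(1) by auto
  show thesis
  proof
    fix z assume z: "\<And>f. f \<in> F \<Longrightarrow> \<bar>blinfun_apply z f - blinfun_apply w f\<bar> < \<epsilon>"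
    have "blinfun_apply z i \<in> X i" for i
    proof (cases "i \<in> F")
      case True
      then show ?thesis using z[OF True] \<epsilon>(2)[OF True] e(2)[of "blinfun_apply z i" i] by linarith
    qed (simp add: F_def)
    then show "z \<in> U" unfolding V(2) using X(4) by auto
  qed (use F \<epsilon> in auto)
qed

lemma topspace_wstar [simp]: "topspace wstar = UNIV"
  unfolding wstar_def topspace_pullback_topology by simp

text \<open>Here G consists exactly of the contact points h = c. Monotonicity is h \<ge> c at
  midpoints; maximality follows by approximating in norm, since G is closed; the nets come from
  approximating in weak-star neighbourhoods.\<close>

theorem strong_representative_gossez_D:
  fixes h :: "'a::banach \<times> 'a dual \<Rightarrow> ereal"
  assumes h: "strong_representative h G"
    and eq: "\<And>x v. h (x, v) \<le> ereal (blinfun_apply v x) \<Longrightarrow> (x, v) \<in> G"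
    and dom: "effdom h \<noteq> {}"
  shows "gossez_D G"
proof -
  have G: "(x, v) \<in> G \<longleftrightarrow> h (x, v) \<le> ereal (blinfun_apply v x)" for x v
    using eq h unfolding strong_representative_def representative_def coupling_def by force
  obtain x0 v0 where "h (x0, v0) < \<infinity>" using dom unfolding effdom_def by auto
  then obtain s0 where s0: "h (x0, v0) \<le> ereal s0"
    by (cases "h (x0, v0)") auto
  have mono: "monotone_op G"
    unfolding monotone_op_def
  proof clarify
    fix x v y u assume "(x, v) \<in> G" "(y, u) \<in> G"
    then have "((x, v), blinfun_apply v x) \<in> epigraph h" "((y, u), blinfun_apply u y) \<in> epigraph h"
      unfolding G epigraph_def by auto
    then have "(1/2::real) *\<^sub>R ((x, v), blinfun_apply v x) + (1/2::real) *\<^sub>R ((y, u), blinfun_apply u y) \<in> epigraph h"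
      by (intro convexD[OF strong_representative_convex[OF h]]) auto
    then have "h ((1/2) *\<^sub>R x + (1/2) *\<^sub>R y, (1/2) *\<^sub>R v + (1/2) *\<^sub>R u) \<le> ereal ((blinfun_apply v x + blinfun_apply u y) / 2)"
      unfolding epigraph_def by (simp add: add_divide_distrib)
    from strong_representative_ge[OF h this]
    show "0 \<le> blinfun_apply (v - u) (x - y)"
      by (simp add: blinfun.add_left blinfun.add_right blinfun.scaleR_left blinfun.scaleR_right
          blinfun.diff_left blinfun.diff_right field_simps)
  qed
  have clG: "closed G"
  proof -
    have "G = (\<lambda>z. (z, blinfun_apply (snd z) (fst z))) -` epigraph h"
      by (auto simp: G epigraph_def)
    then show ?thesis
      using strong_representative_closed[OF h]
      by (auto intro!: continuous_closed_vimage continuous_intros simp: continuous_on_eq_continuous_within[symmetric])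
  qed
  have maxi: "(x, u) \<in> G" if rel: "\<forall>(y, v)\<in>G. 0 \<le> blinfun_apply (u - v) (x - y)" for x u
  proof -
    have "\<exists>z\<in>G. dist z (x, u) < e" if e: "0 < e" for e
    proof -
      obtain y v c where yv: "h (y, v) \<le> ereal (blinfun_apply v y)" "c \<in> cball x (e / 4)"
        "norm (y - c) < e / 4" "norm (v - u) < e / 4"
      proof (rule strong_representative_approx[OF h, of "bidual_emb x" u x0 v0 s0 "cball x (e / 4)" "norm x + e / 4" "e / 4" "e / 4"])
        show "0 \<le> blinfun_apply (bidual_emb x - bidual_emb y) (u - v)" if "h (y, v) \<le> ereal (blinfun_apply v y)" for y v
          using rel that unfolding G[symmetric] by (auto simp: blinfun.diff_left blinfun.diff_right)
        show "norm c \<le> norm x + e / 4" if "c \<in> cball x (e / 4)" for c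
          using that norm_triangle_ineq[of "c - x" x] by (simp add: dist_norm norm_minus_commute)
        show "blinfun_apply (bidual_emb x) p + e / 4 * norm p \<le> m" if le: "\<And>c. c \<in> cball x (e / 4) \<Longrightarrow> blinfun_apply p c \<le> m" for p m
        proof -
          have "blinfun_apply p y \<le> m - blinfun_apply p x" if "norm y \<le> e / 4" for y
            using le[of "x + y"] that by (simp add: blinfun.add_right dist_norm)
          from norm_blinfun_le_if_ball[where R = "e / 4", OF _ this] show ?thesis using e by simp
        qed
      qed (use e s0 in auto)
      have "norm (y - x) \<le> norm (y - c) + norm (c - x)" using norm_triangle_ineq[of "y - c" "c - x"] by simp
      then have "norm (y - x) < e / 2" using yv by (simp add: dist_norm norm_minus_commute)
      then have "norm ((y, v) - (x, u)) < e" using norm_Pair_le[of "y - x" "v - u"] yv(4) e by simp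
      then show ?thesis using yv(1) unfolding G[symmetric] by (auto simp: dist_norm intro!: bexI[of _ "(y, v)"])
    qed
    then have "(x, u) \<in> closure G" unfolding closure_approachable by blast
    then show ?thesis using clG by simp
  qed
  have "\<exists>F :: ('a \<times> 'a dual) filter. F \<noteq> bot \<and> (\<exists>B. bounded B \<and> eventually (\<lambda>p. p \<in> G \<inter> B) F) \<and>
      limitin wstar (\<lambda>p. bidual_emb (fst p)) w F \<and> ((\<lambda>p. snd p) \<longlongrightarrow> u) F"
    if wu: "(w, u) \<in> gossez_closure G" for w u
  proof -
    define R where "R = norm w + 1"
    \<comment> \<open>The radii do not depend on the neighbourhood: C stays in the ball of radius R
      = |w| + 1, and the approximation moves by less than r \<le> 1. This makes the net
      bounded.\<close>
    define B :: "('a \<times> 'a dual) set" where "B = cball 0 (R + 1) \<times> cball 0 (norm u + 1)"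
    define S where "S = (\<lambda>(H, \<delta>). {p \<in> G \<inter> B. (\<forall>f\<in>H. \<bar>blinfun_apply f (fst p) - blinfun_apply w f\<bar> < \<delta>) \<and> norm (snd p - u) < \<delta>})"
    define I :: "('a dual set \<times> real) set" where "I = {H. finite H} \<times> {0<..}"
    \<comment> \<open>The filter with base \<open>S (H, \<delta>)\<close>, directed by unions of the
      finite sets of functionals and minima of the tolerances.\<close>
    define F where "F = (INF i\<in>I. principal (S i))"
    have ne: "S i \<noteq> {}" if i: "i \<in> I" for i
    proof -
      obtain H \<delta> where Hd: "i = (H, \<delta>)" "finite H" "0 < \<delta>" using i unfolding I_def by auto
      define q where "q = (\<Sum>f\<in>H. norm f) + 1"
      have q: "1 \<le> q" unfolding q_def by (simp add: sum_nonneg)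
      have fq: "norm f \<le> q" if "f \<in> H" for f
        unfolding q_def using member_le_sum[of f H norm] Hd(2) that by simp
      \<comment> \<open>A move by r changes each f in H by at most \<delta> / 4. The tolerances then
        add up to \<delta> / 4 + \<delta> / 4 = \<delta> / 2 for membership in C and to \<delta> / 2
        + \<delta> / 4 < \<delta> at the end.\<close>
      define r where "r = min 1 (\<delta> / (4 * q))"
      have r: "0 < r" "r \<le> 1" "r \<le> \<delta> / (4 * q)" unfolding r_def using q Hd by auto
      have rd: "r \<le> \<delta>" using r(3) q Hd(3) by (smt (verit) divide_le_eq mult_le_cancel_left1)
      have rf: "\<bar>blinfun_apply f y\<bar> \<le> \<delta> / 4" if "f \<in> H" "norm y \<le> r" for f y
      proof -
        have "\<bar>blinfun_apply f y\<bar> \<le> norm f * norm y" using norm_blinfun[of f y] by simp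
        also have "\<dots> \<le> q * (\<delta> / (4 * q))" using fq[OF that(1)] that(2) r(3) q by (intro mult_mono) auto
        also have "\<dots> = \<delta> / 4" using q by simp
        finally show ?thesis .
      qed
      define C where "C = {x. norm x \<le> R \<and> (\<forall>f\<in>H. \<bar>blinfun_apply f x - blinfun_apply w f\<bar> \<le> \<delta> / 2)}"
      have supp: "blinfun_apply w p + r * norm p \<le> m" if le: "\<And>c. c \<in> C \<Longrightarrow> blinfun_apply p c \<le> m" for p m
      proof -
        have "blinfun_apply p y \<le> m - blinfun_apply w p" if y: "norm y \<le> r" for y
        proof (rule field_le_epsilon)
          fix \<eta> :: real assume \<eta>: "0 < \<eta>"
          \<comment> \<open>Goldstine for H together with p: x matches w on p up to \<eta>, and x +
            y stays in C for every y of norm at most r.\<close>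
          obtain x where x: "norm x \<le> norm w" "\<And>f. f \<in> insert p H \<Longrightarrow> \<bar>blinfun_apply f x - blinfun_apply w f\<bar> \<le> min \<eta> (\<delta> / 4)"
            using goldstine[of "insert p H" w "norm w" "min \<eta> (\<delta> / 4)"] Hd \<eta> by auto
          have "norm (x + y) \<le> R" using norm_triangle_ineq[of x y] x(1) y r(2) unfolding R_def by simp
          moreover have "\<bar>blinfun_apply f (x + y) - blinfun_apply w f\<bar> \<le> \<delta> / 2" if "f \<in> H" for f
            using order_trans[OF x(2)[OF insertI2[OF that]] min.cobounded2] rf[OF that y]
            unfolding blinfun.add_right by linarith
          ultimately have "blinfun_apply p (x + y) \<le> m" unfolding C_def by (intro le) (auto simp: C_def)
          then show "blinfun_apply p y \<le> m - blinfun_apply w p + \<eta>"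
            using order_trans[OF x(2)[OF insertI1] min.cobounded1] unfolding blinfun.add_right by linarith
        qed
        from norm_blinfun_le_if_ball[where R = r, OF _ this] show ?thesis using r(1) by simp
      qed
      have Cne: "C \<noteq> {}"
      proof -
        obtain x where "norm x \<le> norm w" "\<And>f. f \<in> H \<Longrightarrow> \<bar>blinfun_apply f x - blinfun_apply w f\<bar> \<le> \<delta> / 2"
          using goldstine[of H w "norm w" "\<delta> / 2"] Hd by auto
        then have "x \<in> C" unfolding C_def R_def by auto
        then show ?thesis by auto
      qed
      have Ccv: "convex C"
      proof -
        have "\<bar>a - b\<bar> \<le> \<delta> / 2 \<longleftrightarrow> a \<in> {b - \<delta> / 2 .. b + \<delta> / 2}" for a b
          unfolding atLeastAtMost_iff by linarith
        then have "C = cball 0 R \<inter> (\<Inter>f\<in>H. blinfun_apply f -` {blinfun_apply w f - \<delta> / 2 .. blinfun_apply w f + \<delta> / 2})"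
          unfolding C_def by auto
        moreover have "linear (blinfun_apply f)" for f :: "'a dual"
          by (simp add: blinfun.bounded_linear_right bounded_linear.linear)
        ultimately show ?thesis
          by (auto intro!: convex_Int convex_INT convex_linear_vimage)
      qed
      have rel: "0 \<le> blinfun_apply (w - bidual_emb y) (u - v)" if "h (y, v) \<le> ereal (blinfun_apply v y)" for y v
        using wu that unfolding gossez_closure_def G[symmetric] by auto
      obtain y v c where yv: "h (y, v) \<le> ereal (blinfun_apply v y)" "c \<in> C" "norm (y - c) < r" "norm (v - u) < r"
        using strong_representative_approx[OF h rel s0 Ccv Cne _ r(1) supp r(1), of R] C_def by blast
      have "norm y \<le> R + 1" using norm_triangle_ineq[of "y - c" c] yv(2,3) r(2) unfolding C_def by auto
      moreover have "norm v \<le> norm u + 1" using norm_triangle_ineq[of "v - u" u] yv(4) r(2) by auto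
      moreover have "\<bar>blinfun_apply f y - blinfun_apply w f\<bar> < \<delta>" if f: "f \<in> H" for f
      proof -
        have "\<bar>blinfun_apply f (y - c)\<bar> \<le> \<delta> / 4" using rf[OF f, of "y - c"] yv(3) by simp
        moreover have "\<bar>blinfun_apply f c - blinfun_apply w f\<bar> \<le> \<delta> / 2" using yv(2) f unfolding C_def by auto
        ultimately show ?thesis using Hd(3) unfolding blinfun.diff_right by linarith
      qed
      ultimately have "(y, v) \<in> S i"
        unfolding S_def B_def Hd(1) using yv(1,4) rd G by auto
      then show ?thesis by blast
    qed
    have ev: "eventually P F \<longleftrightarrow> (\<exists>i\<in>I. \<forall>p\<in>S i. P p)" for P
      unfolding F_def
    proof (subst eventually_INF_base)
      show "I \<noteq> {}" unfolding I_def by (auto intro: exI[of _ "1::real"])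
      show "\<exists>x\<in>I. principal (S x) \<le> inf (principal (S i)) (principal (S j))" if "i \<in> I" "j \<in> I" for i j
        using that by (intro bexI[of _ "(fst i \<union> fst j, min (snd i) (snd j))"]) (auto simp: I_def S_def)
    qed (auto simp: eventually_principal)
    have "\<not> eventually (\<lambda>_. False) F" unfolding ev using ne by blast
    then have "F \<noteq> bot" by auto
    moreover have "bounded B" unfolding B_def by (intro bounded_Times) auto
    moreover have "eventually (\<lambda>p. p \<in> G \<inter> B) F"
      unfolding ev by (intro bexI[of _ "({}, 1)"]) (auto simp: S_def I_def)
    moreover have "limitin wstar (\<lambda>p. bidual_emb (fst p)) w F"
      unfolding limitin_def
    proof (intro conjI allI impI)
      fix U assume "openin wstar U \<and> w \<in> U"
      then obtain H \<epsilon> where H: "finite H" "0 < \<epsilon>"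
        "\<And>z. (\<And>f. f \<in> H \<Longrightarrow> \<bar>blinfun_apply z f - blinfun_apply w f\<bar> < \<epsilon>) \<Longrightarrow> z \<in> U"
        using openin_wstar_basic by metis
      then show "\<forall>\<^sub>F p in F. bidual_emb (fst p) \<in> U"
        unfolding ev by (intro bexI[of _ "(H, \<epsilon>)"]) (auto simp: S_def I_def)
    qed simp
    moreover have "((\<lambda>p. snd p) \<longlongrightarrow> u) F"
    proof (rule tendstoI)
      fix e :: real assume "0 < e"
      then show "\<forall>\<^sub>F p in F. dist (snd p) u < e"
        unfolding ev by (intro bexI[of _ "({}, e)"]) (auto simp: S_def I_def dist_norm)
    qed
    ultimately show ?thesis by blast
  qed
  then show ?thesis
    unfolding gossez_D_def maximal_monotone_def using mono maxi by blast
qed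

section \<open>Exactness of the conjugate of the composition\<close>

text \<open>Doubling the residual, d (n + 1) = 2 (d n - j (z n)), expands y as the sum of the terms
  j (z i) / 2^(i + 1). Since C is bounded, the same series in the z i converges; since C is convex
  and closed, its sum lies in C. The closure is removed at the price of half the radius.\<close>

lemma convex_bounded_image_ball:
  fixes j :: "'z::banach \<Rightarrow> 'y::real_normed_vector"
  assumes j: "bounded_linear j" and C: "closed C" "convex C" "\<And>z. z \<in> C \<Longrightarrow> norm z \<le> N"
    and W: "subspace W" "j ` C \<subseteq> W" and r: "ball 0 r \<inter> W \<subseteq> closure (j ` C)"
    and y: "y \<in> W" "norm y < r / 2"
  shows "y \<in> j ` C"
proof -
  have r0: "0 < r" using y(2) norm_ge_zero[of y] by linarith
  \<comment> \<open>A state is a residual with a point of C chosen for it. The residual starts at 2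
    y because the first weight is 1 / 2, which is why |y| < r / 2 is required.\<close>
  define P where "P = (\<lambda>n s. fst s \<in> W \<and> norm (fst s) < r \<and> snd s \<in> C \<and> norm (fst s - j (snd s)) < r / 2
    \<and> (n = (0::nat) \<longrightarrow> fst s = 2 *\<^sub>R y))"
  have ex: "\<exists>z\<in>C. norm (d - j z) < r / 2" if "d \<in> W" "norm d < r" for d
  proof -
    have "d \<in> closure (j ` C)" using r that by auto
    then have "\<exists>b\<in>j ` C. dist b d < r / 2" using half_gt_zero[OF r0] unfolding closure_approachable by blast
    then show ?thesis by (auto simp: dist_norm norm_minus_commute)
  qed
  have "\<exists>f. \<forall>n. P n (f n) \<and> fst (f (Suc n)) = 2 *\<^sub>R (fst (f n) - j (snd (f n)))"
  proof (rule dependent_nat_choice)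
    have "2 *\<^sub>R y \<in> W" "norm (2 *\<^sub>R y) < r" using y W(1) by (auto intro: subspace_scale)
    then obtain z where "z \<in> C" "norm (2 *\<^sub>R y - j z) < r / 2" using ex by blast
    then show "\<exists>s. P 0 s" using \<open>2 *\<^sub>R y \<in> W\<close> \<open>norm (2 *\<^sub>R y) < r\<close>
      unfolding P_def by (intro exI[of _ "(2 *\<^sub>R y, z)"]) auto
  next
    fix s n assume s: "P n s"
    define d where "d = 2 *\<^sub>R (fst s - j (snd s))"
    have "d \<in> W" "norm d < r"
      using s W unfolding P_def d_def by (auto intro!: subspace_scale subspace_diff)
    then obtain z where "z \<in> C" "norm (d - j z) < r / 2" using ex by blast
    then show "\<exists>s'. P (Suc n) s' \<and> fst s' = 2 *\<^sub>R (fst s - j (snd s))"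
      using \<open>d \<in> W\<close> \<open>norm d < r\<close> unfolding P_def d_def[symmetric] by (intro exI[of _ "(d, z)"]) auto
  qed
  then obtain f where f: "\<And>n. P n (f n)" "\<And>n. fst (f (Suc n)) = 2 *\<^sub>R (fst (f n) - j (snd (f n)))" by blast
  define d z where "d n = fst (f n)" and "z n = snd (f n)" for n
  have dz: "norm (d n) < r" "z n \<in> C" "d 0 = 2 *\<^sub>R y" "d (Suc n) = 2 *\<^sub>R (d n - j (z n))" for n
    using f(1)[of n] f(1)[of 0] f(2)[of n] unfolding P_def d_def z_def by auto
  define S where "S n = (\<Sum>i<n. (1 / 2) ^ Suc i *\<^sub>R z i)" for n
  interpret j: bounded_linear j by (rule j)
  have jS: "j (S n) = y - (1 / 2) ^ Suc n *\<^sub>R d n" for n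
  proof (induction n)
    case 0
    then show ?case unfolding S_def dz(3) by (simp add: j.zero)
  next
    case (Suc n)
    have "j (S (Suc n)) = y - (1 / 2) ^ Suc n *\<^sub>R d n + (1 / 2) ^ Suc n *\<^sub>R j (z n)"
      using Suc unfolding S_def by (simp add: j.add j.scaleR)
    also have "\<dots> = y - (1 / 2) ^ Suc (Suc n) *\<^sub>R d (Suc n)"
      unfolding dz(4) by (simp add: scaleR_diff_right)
    finally show ?case .
  qed
  \<comment> \<open>A partial sum has total weight 1 - 2^-n; giving the missing weight to any point
    of C completes a convex combination.\<close>
  have SC: "S n + (1 / 2) ^ n *\<^sub>R p \<in> C" if "p \<in> C" for n p
    using that
  proof (induction n arbitrary: p)
    case 0
    then show ?case unfolding S_def by simp
  next
    case (Suc n)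
    have "(1 / 2 :: real) *\<^sub>R z n + (1 / 2 :: real) *\<^sub>R p \<in> C"
      using convexD[OF C(2) dz(2)[of n] Suc.prems, of "1 / 2" "1 / 2"] by simp
    from Suc.IH[OF this] show ?case unfolding S_def by (simp add: scaleR_add_right mult.commute add.assoc)
  qed
  have sm: "summable (\<lambda>i. (1 / 2 :: real) ^ Suc i * N)"
    by (intro summable_mult2 summable_ignore_initial_segment[of "\<lambda>i. (1 / 2 :: real) ^ i" 1, simplified] summable_geometric) simp
  have "norm ((1 / 2 :: real) ^ Suc i *\<^sub>R z i) \<le> (1 / 2) ^ Suc i * N" for i
    using C(3)[OF dz(2)[of i]] by (simp add: mult_left_mono)
  then have "summable (\<lambda>i. (1 / 2 :: real) ^ Suc i *\<^sub>R z i)"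
    by (rule summable_comparison_test'[OF sm, of 0])
  then obtain s where s: "S \<longlonglongrightarrow> s" unfolding S_def summable_def sums_def by blast
  have p0: "(\<lambda>n. (1 / 2 :: real) ^ n) \<longlonglongrightarrow> 0" by (rule LIMSEQ_power_zero) simp
  have "(\<lambda>n. S n + (1 / 2) ^ n *\<^sub>R z 0) \<longlonglongrightarrow> s + 0 *\<^sub>R z 0"
    by (intro tendsto_intros s p0)
  then have sC: "s \<in> C"
    using closed_sequentially[OF C(1), of "\<lambda>n. S n + (1 / 2) ^ n *\<^sub>R z 0" s] SC[OF dz(2)] by simp
  have "(\<lambda>n. (1 / 2) ^ Suc n *\<^sub>R d n) \<longlonglongrightarrow> 0"
  proof (rule Lim_null_comparison)
    show "\<forall>\<^sub>F n in sequentially. norm ((1 / 2) ^ Suc n *\<^sub>R d n) \<le> (1 / 2) ^ n * (r / 2)"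
      using dz(1) by (intro always_eventually) (simp add: less_imp_le)
    show "(\<lambda>n. (1 / 2) ^ n * (r / 2)) \<longlonglongrightarrow> 0"
      using tendsto_mult_right[OF p0, of "r / 2"] by simp
  qed
  then have "(\<lambda>n. j (S n)) \<longlonglongrightarrow> y - 0" unfolding jS by (intro tendsto_intros)
  moreover have "(\<lambda>n. j (S n)) \<longlonglongrightarrow> j s" by (rule j.tendsto[OF s])
  ultimately have "j s = y" using LIMSEQ_unique by fastforce
  then show ?thesis using sC by blast
qed

text \<open>Baire's theorem gives, near 0, preimages in bounded pieces of C,
  on which f is bounded above, and convexity turns this into a linear lower bound.\<close>
lemma convex_penalty_exact:
  fixes j :: "'z::banach \<Rightarrow> 'y::banach" and f :: "'z \<Rightarrow> real"
  assumes j: "bounded_linear j" and f: "bounded_linear f" and C: "closed C" "convex C"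
    and W: "subspace W" "closed W" "j ` C \<subseteq> W"
    and absorb: "\<And>y. y \<in> W \<Longrightarrow> \<exists>\<delta>>0. \<forall>t\<in>{0..\<delta>}. t *\<^sub>R y \<in> j ` C"
    and ge: "\<And>z. z \<in> C \<Longrightarrow> j z = 0 \<Longrightarrow> b \<le> f z"
  shows "\<exists>K\<ge>0. \<forall>z\<in>C. b \<le> K * norm (j z) + f z"
proof -
  interpret j: bounded_linear j by (rule j)
  interpret f: bounded_linear f by (rule f)
  define B where "B N = j ` (C \<inter> cball 0 N)" for N :: real
  have Bcv: "convex (B N)" for N
    unfolding B_def by (intro convex_linear_image convex_Int C convex_cball j.linear)
  have Bmono: "N \<le> N' \<Longrightarrow> B N \<subseteq> B N'" for N N' unfolding B_def by auto
  \<comment> \<open>By absorption these multiples of images of bounded pieces cover W, which is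
    complete as a closed subspace; so one of the closures has interior relative to W.\<close>
  define T where "T = (\<lambda>(m, n). W \<inter> (*\<^sub>R) (real (Suc m)) ` closure (B (real n)))"
  have cover: "W \<subseteq> (\<Union>i. T i)"
  proof
    fix y assume y: "y \<in> W"
    obtain \<delta> where \<delta>: "\<delta> > 0" "\<And>t. t \<in> {0..\<delta>} \<Longrightarrow> t *\<^sub>R y \<in> j ` C" using absorb[OF y] by blast
    obtain m where m: "inverse (real (Suc m)) < \<delta>" using reals_Archimedean[OF \<delta>(1)] by auto
    then have "inverse (real (Suc m)) *\<^sub>R y \<in> j ` C" by (intro \<delta>(2)) auto
    then obtain z where z: "z \<in> C" "inverse (real (Suc m)) *\<^sub>R y = j z" by auto
    obtain n where n: "norm z \<le> real n" using real_arch_simple by blast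
    have "j z \<in> closure (B (real n))" using z(1) n closure_subset unfolding B_def by force
    moreover have "y = real (Suc m) *\<^sub>R j z" using z(2)[symmetric] by simp
    ultimately have "y \<in> T (m, n)" unfolding T_def using y by blast
    then show "y \<in> (\<Union>i. T i)" by blast
  qed
  have "\<exists>i. top_of_set W interior_of T i \<noteq> {}"
  proof (rule ccontr)
    assume "\<not> ?thesis"
    then have "top_of_set W interior_of \<Union>(range T) = {}"
    proof (intro Baire_category_alt)
      show "completely_metrizable_space (top_of_set W) \<or> locally_compact_space (top_of_set W) \<and> regular_space (top_of_set W)"
        using W(2) completely_metrizable_space_closedin completely_metrizable_space_euclidean
        by (metis closed_closedin)
      show "closedin (top_of_set W) S \<and> top_of_set W interior_of S = {}"
        if "\<not> (\<exists>i. top_of_set W interior_of T i \<noteq> {})" "S \<in> range T" for S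
        using that unfolding T_def by (auto intro!: closedin_closed_Int closed_scaling)
    qed auto
    moreover have "\<Union>(range T) = W" using cover unfolding T_def by auto
    ultimately have "W = {}" using interior_of_topspace[of "top_of_set W"] by simp
    then show False using subspace_0[OF W(1)] by auto
  qed
  then obtain m n y1 where "y1 \<in> top_of_set W interior_of T (m, n)" by (metis all_not_in_conv surj_pair)
  then obtain U where U: "openin (top_of_set W) U" "y1 \<in> U" "U \<subseteq> T (m, n)"
    unfolding interior_of_def by auto
  then obtain \<rho> where \<rho>: "\<rho> > 0" "ball y1 \<rho> \<inter> W \<subseteq> U" unfolding openin_contains_ball by blast
  have y1: "y1 \<in> W" using U openin_subset by fastforce
  define a where "a = inverse (real (Suc m))"
  have a: "0 < a" unfolding a_def by simp
  have in_cl: "a *\<^sub>R y \<in> closure (B (real n))" if y: "y \<in> ball y1 \<rho>" "y \<in> W" for y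
  proof -
    have "y \<in> T (m, n)" using \<rho>(2) U(3) y by blast
    then obtain c where "c \<in> closure (B (real n))" "y = real (Suc m) *\<^sub>R c" unfolding T_def by auto
    then show ?thesis unfolding a_def by simp
  qed
  \<comment> \<open>The interior sits around y1, possibly far from 0. Absorption also puts a
    negative multiple of y1 into the image, and \<mu> below balances the two so that a relative ball
    around 0 lies in the closure.\<close>
  have "- y1 \<in> W" using y1 W(1) by (simp add: subspace_neg)
  then obtain t where t: "t > 0" "t *\<^sub>R (- y1) \<in> j ` C" using absorb by force
  then obtain z2 where z2: "z2 \<in> C" "j z2 = - (t *\<^sub>R y1)" by auto
  define N where "N = max (real n) (norm z2)"
  define \<mu> where "\<mu> = t / (t + a)"
  have \<mu>: "0 < \<mu>" "\<mu> \<le> 1" "(1 - \<mu>) * t = \<mu> * a" unfolding \<mu>_def using t(1) a by (auto simp: field_simps)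
  define r where "r = \<mu> * a * \<rho>"
  have r: "0 < r" unfolding r_def using \<mu> a \<rho> by simp
  have "ball 0 r \<inter> W \<subseteq> closure (B N)"
  proof
    fix v assume v: "v \<in> ball 0 r \<inter> W"
    define y where "y = y1 + inverse (\<mu> * a) *\<^sub>R v"
    have "norm v < \<mu> * a * \<rho>" using v unfolding r_def by simp
    then have "inverse (\<mu> * a) * norm v < \<rho>" using \<mu> a by (simp add: field_simps)
    then have "y \<in> ball y1 \<rho>" using \<mu> a unfolding y_def by (simp add: dist_norm)
    moreover have "y \<in> W" unfolding y_def using y1 v W(1) by (intro subspace_add subspace_scale) auto
    ultimately have "a *\<^sub>R y \<in> closure (B (real n))" by (rule in_cl)
    then have 1: "a *\<^sub>R y \<in> closure (B N)" using closure_mono[OF Bmono[of "real n" N]] unfolding N_def by auto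
    have 2: "j z2 \<in> closure (B N)" using z2(1) closure_subset unfolding B_def N_def by force
    have "\<mu> *\<^sub>R (a *\<^sub>R y) + (1 - \<mu>) *\<^sub>R j z2 \<in> closure (B N)"
      by (rule convexD[OF convex_closure[OF Bcv] 1 2]) (use \<mu> in auto)
    moreover have "\<mu> *\<^sub>R (a *\<^sub>R y) + (1 - \<mu>) *\<^sub>R j z2 = v"
    proof -
      have "\<mu> * (a * (inverse \<mu> * inverse a)) = 1" using \<mu>(1) a by (simp add: field_simps)
      then show ?thesis unfolding y_def z2(2) using \<mu> by (simp add: scaleR_add_right)
    qed
    ultimately show "v \<in> closure (B N)" by simp
  qed
  then have small: "y \<in> B N" if "y \<in> W" "norm y < r / 2" for y
    unfolding B_def
    by (intro convex_bounded_image_ball[OF j _ _ _ W(1), where N = N and r = r])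
      (use that C W(3) in \<open>auto simp: B_def closed_Int convex_Int\<close>)
  obtain Kf where Kf: "0 \<le> Kf" "\<And>z. norm (f z) \<le> norm z * Kf" using f.nonneg_bounded by blast
  define M where "M = N * Kf"
  define q where "q = r / 4"
  have q: "0 < q" unfolding q_def using r by simp
  have bd: "\<exists>z\<in>C. j z = y \<and> f z \<le> M" if yW: "y \<in> W" and yq: "norm y \<le> q" for y
  proof -
    obtain z where z: "z \<in> C" "norm z \<le> N" "j z = y"
      using small[OF yW] yq r unfolding q_def B_def by auto
    have "f z \<le> norm z * Kf" using Kf(2)[of z] by simp
    also have "\<dots> \<le> M" unfolding M_def using z(2) Kf(1) by (rule mult_right_mono)
    finally show ?thesis using z by blast
  qed
  have W0: "0 \<in> W" by (rule subspace_0[OF W(1)])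
  have bM: "b \<le> M" using bd[OF W0] ge q by fastforce
  define K where "K = (M - b) / q"
  have K: "0 \<le> K" unfolding K_def using bM q by simp
  have "b \<le> K * norm (j z) + f z" if z: "z \<in> C" for z
  proof (cases "j z = 0")
    case True
    then show ?thesis using ge[OF z] by simp
  next
    case False
    define d where "d = norm (j z)"
    have d: "0 < d" unfolding d_def using False by simp
    \<comment> \<open>A point opposite to j z with norm q: it has a preimage at which f is at most
      M, and the weight \<tau> makes the convex combination satisfy the constraint j = 0.\<close>
    define y where "y = - (q / d) *\<^sub>R j z"
    have "y \<in> W" unfolding y_def using z W(1,3) by (intro subspace_scale) auto
    moreover have "norm y \<le> q" unfolding y_def using d q unfolding d_def by simp
    ultimately obtain z' where z': "z' \<in> C" "j z' = y" "f z' \<le> M" using bd by blast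
    define \<tau> where "\<tau> = d / (d + q)"
    have \<tau>: "0 \<le> \<tau>" "\<tau> \<le> 1" "1 - \<tau> = q / (d + q)" unfolding \<tau>_def using d q by (auto simp: field_simps)
    define z'' where "z'' = (1 - \<tau>) *\<^sub>R z + \<tau> *\<^sub>R z'"
    have "z'' \<in> C" unfolding z''_def by (rule convexD[OF C(2) z z'(1)]) (use \<tau> in auto)
    moreover have "\<tau> * (q / d) = 1 - \<tau>" unfolding \<tau>(3) using d q by (simp add: \<tau>_def)
    then have "j z'' = 0" unfolding z''_def j.add j.scaleR z'(2) y_def by simp
    ultimately have "b \<le> (1 - \<tau>) * f z + \<tau> * f z'" using ge[of z''] unfolding z''_def f.add f.scaleR by simp
    also have "\<dots> \<le> (1 - \<tau>) * f z + \<tau> * M" using z'(3) \<tau>(1) by (simp add: mult_left_mono)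
    also have "\<dots> = (q * f z + d * M) / (d + q)" unfolding \<tau>(3) unfolding \<tau>_def by (simp add: add_divide_distrib)
    finally have "b * (d + q) \<le> q * f z + d * M" using d q by (simp add: pos_le_divide_eq)
    then show ?thesis unfolding K_def d_def[symmetric] using q by (simp add: field_simps)
  qed
  then show ?thesis using K by blast
qed

section \<open>Adjoints, and the multiplier under condition (a)\<close>

lemma bounded_linear_adjoint: "bounded_linear (adjoint A)"
  unfolding adjoint_def by (rule bounded_bilinear.bounded_linear_left[OF bounded_bilinear_blinfun_compose])

lemma adjoint_apply [simp]: "blinfun_apply (adjoint A v) x = blinfun_apply v (blinfun_apply A x)"
  unfolding adjoint_def by simp

lemma biadjoint_apply [simp]: "blinfun_apply (biadjoint A w) v = blinfun_apply w (adjoint A v)"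
  unfolding biadjoint_def by (simp add: bounded_linear_Blinfun_apply[OF bounded_linear_adjoint])

lemma blinfun_eq_zero_if_bounded_above:
  fixes f :: "'a::real_normed_vector \<Rightarrow>\<^sub>L real"
  assumes "\<And>x. blinfun_apply f x \<le> m"
  shows "f = 0"
proof (rule ccontr)
  assume "f \<noteq> 0"
  then have n: "0 < norm f" by simp
  have "0 \<le> m" using assms[of 0] by simp
  then have "(m + 1) / norm f * norm f \<le> m"
    using n by (intro norm_blinfun_le_if_ball assms) auto
  then show False using n by simp
qed

text \<open>Consider f = s - u x - w (A* v) over the epigraph of h and all x under the constraint j
  = y - A x = 0; \<open>bound\<close> says that f is at least - \<alpha> there. Exact penalisation
  gives a multiplier L for the constraint. As x ranges over the whole space, u + A* L vanishes, and
  v0 = - L.\<close>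

lemma conjugate_attained_ic:
  fixes A :: "'x::banach \<Rightarrow>\<^sub>L 'y::banach" and h :: "'y \<times> 'y dual \<Rightarrow> ereal"
  assumes h: "convex (epigraph h)" "closed (epigraph h)"
    and dom: "fst ` effdom h \<inter> range (blinfun_apply A) \<noteq> {}"
    and ic: "0 \<in> ic (set_diff_mink (fst ` effdom h) (range (blinfun_apply A)))"
    and bound: "\<And>x v s. h (blinfun_apply A x, v) \<le> ereal s \<Longrightarrow> blinfun_apply u x + blinfun_apply w (adjoint A v) - s \<le> \<alpha>"
  shows "\<exists>v0. adjoint A v0 = u \<and> fconj h (v0, biadjoint A w) \<le> ereal \<alpha>"
proof -
  define D where "D = set_diff_mink (fst ` effdom h) (range (blinfun_apply A))"
  define W where "W = affine hull D"
  define C where "C = epigraph h \<times> (UNIV :: 'x set)"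
  define j where "j = (\<lambda>z::(('y \<times> 'y dual) \<times> real) \<times> 'x. fst (fst (fst z)) - blinfun_apply A (snd z))"
  define f where "f = (\<lambda>z::(('y \<times> 'y dual) \<times> real) \<times> 'x.
    snd (fst z) - blinfun_apply u (snd z) - blinfun_apply w (adjoint A (snd (fst (fst z)))))"
  have blj: "bounded_linear j" unfolding j_def
    by (intro bounded_linear_intros)
  have blf: "bounded_linear f" unfolding f_def
    by (intro bounded_linear_intros bounded_linear_compose[OF bounded_linear_adjoint])
  have ex_real: "(\<exists>s. h p \<le> ereal s) \<longleftrightarrow> p \<in> effdom h" for p
    unfolding effdom_def by (cases "h p") auto
  have jC: "j ` C = D"
  proof -
    have "j ` C = {fst p - blinfun_apply A x | p x. \<exists>s. h p \<le> ereal s}"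
    proof (intro subset_antisym subsetI)
      fix y assume "y \<in> j ` C"
      then obtain p s x where "((p, s), x) \<in> C" "y = j ((p, s), x)" by auto
      then have "h p \<le> ereal s" "y = fst p - blinfun_apply A x"
        unfolding j_def C_def epigraph_def by auto
      then show "y \<in> {fst p - blinfun_apply A x | p x. \<exists>s. h p \<le> ereal s}" by blast
    next
      fix y assume "y \<in> {fst p - blinfun_apply A x | p x. \<exists>s. h p \<le> ereal s}"
      then obtain p s x where "h p \<le> ereal s" "y = fst p - blinfun_apply A x" by auto
      then have "((p, s), x) \<in> C" "y = j ((p, s), x)" unfolding C_def epigraph_def j_def by auto
      then show "y \<in> j ` C" by blast
    qed
    also have "\<dots> = D" unfolding ex_real D_def set_diff_mink_def by blast
    finally show ?thesis .
  qed
  have D0: "0 \<in> D" using dom unfolding D_def set_diff_mink_def by force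
  have Wspan: "W = span D" unfolding W_def using affine_hull_span_0[of D] hull_inc[OF D0] by simp
  have ic': "closed W" "0 \<in> icr D" using ic unfolding ic_def D_def[symmetric] W_def by (auto split: if_splits)
  have absorb: "\<exists>\<delta>>0. \<forall>t\<in>{0..\<delta>}. t *\<^sub>R y \<in> j ` C" if "y \<in> W" for y
  proof -
    have "D \<subseteq> set_diff_mink D D" using D0 unfolding set_diff_mink_def by force
    then have "y \<in> affine hull (set_diff_mink D D)" using that hull_mono unfolding W_def by blast
    then show ?thesis using ic'(2) unfolding icr_def jC by auto
  qed
  have "\<exists>K\<ge>0. \<forall>z\<in>C. - \<alpha> \<le> K * norm (j z) + f z"
  proof (rule convex_penalty_exact[OF blj blf _ _ _ ic'(1) _ absorb])
    show "closed C" "convex C" unfolding C_def using h by (auto intro: closed_Times convex_Times)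
    show "subspace W" "j ` C \<subseteq> W" unfolding Wspan jC using span_superset by auto
    show "- \<alpha> \<le> f z" if "z \<in> C" "j z = 0" for z
      using bound[of "snd z" "snd (fst (fst z))" "snd (fst z)"] that
      unfolding C_def j_def f_def epigraph_def by (cases z) auto
  qed
  then obtain K where K: "0 \<le> K" "\<And>z. z \<in> C \<Longrightarrow> - \<alpha> \<le> K * norm (j z) + f z" by blast
  define S where "S = (\<lambda>z. (j z, f z)) ` C"
  have "convex S" unfolding S_def
  proof (rule convex_linear_image)
    show "linear (\<lambda>z. (j z, f z))"
      using bounded_linear_Pair[OF blj blf] by (rule bounded_linear.linear)
    show "convex C" unfolding C_def using h by (auto intro: convex_Times)
  qed
  moreover obtain p0 s0 where p0: "h p0 \<le> ereal s0" using dom ex_real by blast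
  then have "((p0, s0), 0) \<in> C" unfolding C_def epigraph_def by simp
  then have "S \<noteq> {}" unfolding S_def by blast
  moreover have "- \<alpha> \<le> K * norm e + k" if "(e, k) \<in> S" for e k
    using that K(2) unfolding S_def by auto
  ultimately obtain L :: "'y \<Rightarrow>\<^sub>L real" where L: "\<And>z. z \<in> C \<Longrightarrow> - \<alpha> \<le> blinfun_apply L (j z) + f z"
    using mazur_orlicz_normed[OF K(1), of S "- \<alpha>"] unfolding S_def by blast
  have key: "- \<alpha> \<le> blinfun_apply L y - blinfun_apply L (blinfun_apply A x) + s - blinfun_apply u x - blinfun_apply w (adjoint A v)"
    if "h (y, v) \<le> ereal s" for y v s x
    using L[of "(((y, v), s), x)"] that unfolding C_def epigraph_def j_def f_def by (simp add: blinfun.diff_right)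
  have "u + adjoint A L = 0"
  proof (rule blinfun_eq_zero_if_bounded_above)
    fix x
    show "blinfun_apply (u + adjoint A L) x \<le> \<alpha> + blinfun_apply L (fst p0) + s0 - blinfun_apply w (adjoint A (snd p0))"
      using key[of "fst p0" "snd p0" s0 x] p0 by (simp add: blinfun.add_left)
  qed
  then have "adjoint A (- L) = u"
    using linear_neg[OF bounded_linear.linear[OF bounded_linear_adjoint], of A L] by (simp add: add_eq_0_iff)
  moreover have "fconj h (- L, biadjoint A w) \<le> ereal \<alpha>"
    unfolding fconj_le_iff using key[of _ _ _ 0] by (auto simp: blinfun.minus_left algebra_simps)
  ultimately show ?thesis by blast
qed

section \<open>Contact points, Fenchel-Moreau and condition (b)\<close>

text \<open>On the segment from (x, v) to (y, u), h stays above c and touches it at the start.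
  Dividing by t and letting t tend to 0 leaves the tangent inequality, which bounds every term of
  the conjugate at (v, x).\<close>

lemma strong_representative_conj_at_contact:
  assumes h: "strong_representative h G" and xv: "h (x, v) \<le> ereal (blinfun_apply v x)"
  shows "fconj h (v, bidual_emb x) \<le> ereal (blinfun_apply v x)"
  unfolding fconj_le_iff
proof (intro allI impI)
  fix y u s assume yu: "h (y, u) \<le> ereal s"
  define a where "a = blinfun_apply v y + blinfun_apply u x - blinfun_apply v x"
  define b where "b = a - blinfun_apply u y"
  have key: "a - t * b \<le> s" if t: "0 < t" "t \<le> 1" for t
  proof -
    have "(1 - t) *\<^sub>R ((x, v), blinfun_apply v x) + t *\<^sub>R ((y, u), s) \<in> epigraph h"
      by (rule convexD[OF strong_representative_convex[OF h]]) (use xv yu t in \<open>auto simp: epigraph_def\<close>)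
    then have "h ((1 - t) *\<^sub>R x + t *\<^sub>R y, (1 - t) *\<^sub>R v + t *\<^sub>R u) \<le> ereal ((1 - t) * blinfun_apply v x + t * s)"
      unfolding epigraph_def by simp
    from strong_representative_ge[OF h this]
    have "(1 - t) * ((1 - t) * blinfun_apply v x + t * blinfun_apply u x) + t * ((1 - t) * blinfun_apply v y + t * blinfun_apply u y)
        \<le> (1 - t) * blinfun_apply v x + t * s"
      by (simp only: blinfun.add_left blinfun.add_right blinfun.scaleR_left blinfun.scaleR_right real_scaleR_def)
    then have "t * (a - t * b) \<le> t * s"
      unfolding b_def a_def by (simp add: algebra_simps)
    then show ?thesis using t by simp
  qed
  have "a \<le> s"
  proof (rule field_le_epsilon)
    fix e :: real assume e: "0 < e"
    define t where "t = min 1 (e / (\<bar>b\<bar> + 1))"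
    have t: "0 < t" "t \<le> 1" "t \<le> e / (\<bar>b\<bar> + 1)" unfolding t_def using e by auto
    have "t * b \<le> t * (\<bar>b\<bar> + 1)" using t(1) by (intro mult_left_mono) auto
    also have "\<dots> \<le> e" using t(3) by (simp add: pos_le_divide_eq add_nonneg_pos)
    finally show "a \<le> s + e" using key[OF t(1,2)] by simp
  qed
  then show "blinfun_apply v y + blinfun_apply (bidual_emb x) u - s \<le> blinfun_apply v x"
    unfolding a_def by simp
qed

text \<open>The contact point provides an affine minorant, which controls h far away; closedness
  gives a gap near (y, u). Together they place a cone m1 - K |z - z0| below h, and separation along
  this cone produces an affine minorant with value m1 > m at (y, u).\<close>

lemma strong_representative_fenchel_moreau:
  fixes h :: "'a::real_normed_vector \<times> 'a dual \<Rightarrow> ereal"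
  assumes h: "strong_representative h G" and contact: "h (x, v) \<le> ereal (blinfun_apply v x)"
    and le: "\<And>p q r. fconj h (p, q) \<le> ereal r \<Longrightarrow> blinfun_apply p y + blinfun_apply q u - r \<le> m"
  shows "h (y, u) \<le> ereal m"
proof (rule ccontr)
  assume "\<not> h (y, u) \<le> ereal m"
  then have "((y, u), m) \<notin> epigraph h" unfolding epigraph_def by simp
  then obtain \<rho> where \<rho>: "0 < \<rho>" "\<And>z s. dist (z, s) ((y, u), m) < \<rho> \<Longrightarrow> (z, s) \<notin> epigraph h"
    using strong_representative_closed[OF h] unfolding closed_def open_dist by (metis ComplD ComplI)
  define z0 where "z0 = (y, u)"
  define m1 where "m1 = m + \<rho> / 4"
  have near: "m1 \<le> s" if z: "(z, s) \<in> epigraph h" "norm (z - z0) < \<rho> / 2" for z s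
  proof (rule ccontr)
    assume s: "\<not> m1 \<le> s"
    \<comment> \<open>Raising the height to max s m stays in the epigraph and comes within \<rho> of
      ((y, u), m) even if s is far below m.\<close>
    have "norm (z - z0, max s m - m) \<le> norm (z - z0) + norm (max s m - m)" by (rule norm_Pair_le)
    also have "\<dots> < \<rho>" using z(2) s \<rho>(1) unfolding m1_def by (auto simp: max_def)
    finally have "(z, max s m) \<notin> epigraph h" by (intro \<rho>(2)) (simp add: dist_norm z0_def)
    moreover have "h z \<le> ereal (max s m)" using z(1) order_trans[of "h z" "ereal s" "ereal (max s m)"]
      unfolding epigraph_def by simp
    ultimately show False unfolding epigraph_def by simp
  qed
  define l where "l z = blinfun_apply v (fst z) + blinfun_apply (snd z) x" for z :: "'a \<times> 'a dual"
  define c where "c = norm v + norm x"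
  have minorant: "l z - blinfun_apply v x \<le> s" if "(z, s) \<in> epigraph h" for z s
    using strong_representative_conj_at_contact[OF h contact] that
    unfolding fconj_le_iff epigraph_def l_def by (cases z) (force simp: algebra_simps)
  have llip: "l z0 - c * norm (z - z0) \<le> l z" for z
  proof -
    have "l z0 - l z = blinfun_apply v (fst (z0 - z)) + blinfun_apply (snd (z0 - z)) x"
      unfolding l_def by (simp add: blinfun.diff_left blinfun.diff_right)
    also have "\<dots> \<le> norm v * norm (fst (z0 - z)) + norm (snd (z0 - z)) * norm x"
      by (intro add_mono blinfun_le_norm)
    also have "\<dots> \<le> norm v * norm (z - z0) + norm (z - z0) * norm x"
    proof -
      have "norm (fst (z0 - z)) \<le> norm (z - z0)" "norm (snd (z0 - z)) \<le> norm (z - z0)"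
        using norm_fst_le norm_snd_le norm_minus_commute by (metis prod.collapse)+
      then show ?thesis by (intro add_mono mult_left_mono mult_right_mono) auto
    qed
    finally show ?thesis unfolding c_def by (simp add: algebra_simps)
  qed
  \<comment> \<open>Slope c pays for the Lipschitz constant of the minorant; the second summand
    lifts it to m1 from distance \<rho> / 2 onwards.\<close>
  define K where "K = c + max 0 ((m1 - l z0 + blinfun_apply v x) / (\<rho> / 2))"
  have c0: "0 \<le> c" unfolding c_def by simp
  have K: "c \<le> K" "m1 - l z0 + blinfun_apply v x \<le> (K - c) * (\<rho> / 2)"
  proof -
    show "c \<le> K" unfolding K_def by simp
    have "(m1 - l z0 + blinfun_apply v x) / (\<rho> / 2) \<le> K - c" unfolding K_def by simp
    then show "m1 - l z0 + blinfun_apply v x \<le> (K - c) * (\<rho> / 2)"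
      using \<rho>(1) by (subst (asm) pos_divide_le_eq) auto
  qed
  have low: "m1 \<le> K * norm (z - z0) + s" if z: "(z, s) \<in> epigraph h" for z s
  proof (cases "norm (z - z0) < \<rho> / 2")
    case True
    have "0 \<le> K * norm (z - z0)" using K(1) c0 by simp
    then show ?thesis using near[OF z True] by linarith
  next
    case False
    have "(K - c) * (\<rho> / 2) \<le> (K - c) * norm (z - z0)"
      using False K(1) by (intro mult_left_mono) auto
    moreover have "(K - c) * norm (z - z0) = K * norm (z - z0) - c * norm (z - z0)" by (rule left_diff_distrib)
    ultimately show ?thesis using minorant[OF z] llip[of z] K(2) by linarith
  qed
  define S where "S = (\<lambda>w. (- z0, 0) + w) ` epigraph h"
  have "convex S" "S \<noteq> {}"
    unfolding S_def using strong_representative_convex[OF h] contact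
    by (auto simp: convex_translation epigraph_def)
  moreover have "m1 \<le> K * norm e + k" if "(e, k) \<in> S" for e k
  proof -
    have "(e + z0, k) \<in> epigraph h" using that unfolding S_def by auto
    from low[OF this] show ?thesis by simp
  qed
  ultimately obtain L :: "('a \<times> 'a dual) \<Rightarrow>\<^sub>L real" where "\<And>e k. (e, k) \<in> S \<Longrightarrow> m1 \<le> blinfun_apply L e + k"
    using mazur_orlicz_normed[of K S m1] K(1) c0 by fastforce
  then have L: "m1 \<le> blinfun_apply L (z - z0) + s" if "(z, s) \<in> epigraph h" for z s
  proof -
    have "(z - z0, s) \<in> S" unfolding S_def by (rule image_eqI[OF _ that]) simp
    then show ?thesis using \<open>\<And>e k. (e, k) \<in> S \<Longrightarrow> m1 \<le> blinfun_apply L e + k\<close> by blast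
  qed
  obtain p q where pq: "\<And>x v. blinfun_apply L (x, v) = blinfun_apply p x + blinfun_apply q v"
    using blinfun_prod_split by blast
  have "fconj h (- p, - q) \<le> ereal (- blinfun_apply p y - blinfun_apply q u - m1)"
    unfolding fconj_le_iff
  proof (intro allI impI)
    fix x' v' s assume "h (x', v') \<le> ereal s"
    then have "m1 \<le> blinfun_apply L ((x', v') - z0) + s" by (intro L) (simp add: epigraph_def)
    then show "blinfun_apply (- p) x' + blinfun_apply (- q) v' - s \<le> - blinfun_apply p y - blinfun_apply q u - m1"
      unfolding z0_def by (simp add: pq blinfun.minus_left blinfun.diff_right)
  qed
  from le[OF this] show False unfolding m1_def using \<rho>(1) by (simp add: blinfun.minus_left)
qed

text \<open>By closedness it suffices that (u, A** w, \<alpha>) lies in the weak-star closure.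
  Otherwise separation gives x1, v2 and a slope t \<ge> 0 in the real coordinate. For t > 0
  rescaling yields a point that violates \<open>bound\<close>; for t = 0 a recession direction of h
  violates it far out.\<close>

lemma conjugate_attained_closed:
  fixes A :: "'x::real_normed_vector \<Rightarrow>\<^sub>L 'y::real_normed_vector" and h :: "'y \<times> 'y dual \<Rightarrow> ereal"
  assumes h: "strong_representative h G" and contact: "h (y1, v1) \<le> ereal (blinfun_apply v1 y1)"
    and dom: "h (blinfun_apply A x0, v0) \<le> ereal s0"
    and cl: "closed_regarding (prod_topology wstar (prod_topology wstar euclideanreal))
          {(adjoint A v, w, r) | v w r. fconj h (v, w) \<le> ereal r}
          (UNIV \<times> range (biadjoint A) \<times> UNIV)"
    and bound: "\<And>x v s. h (blinfun_apply A x, v) \<le> ereal s \<Longrightarrow> blinfun_apply u x + blinfun_apply w (adjoint A v) - s \<le> \<alpha>"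
  shows "\<exists>v0. adjoint A v0 = u \<and> fconj h (v0, biadjoint A w) \<le> ereal \<alpha>"
proof -
  define \<tau> where "\<tau> = prod_topology (wstar :: 'x dual topology) (prod_topology (wstar :: 'y bidual topology) euclideanreal)"
  define Q where "Q = {(adjoint A v, w, r) | v w r. fconj h (v, w) \<le> ereal r}"
  define w' where "w' = biadjoint A w"
  have "(u, w', \<alpha>) \<in> \<tau> closure_of Q"
  proof (rule ccontr)
    assume "(u, w', \<alpha>) \<notin> \<tau> closure_of Q"
    moreover have "(u, w', \<alpha>) \<in> topspace \<tau>" unfolding \<tau>_def by simp
    ultimately obtain T where T: "openin \<tau> T" "(u, w', \<alpha>) \<in> T" "T \<inter> Q = {}"
      unfolding in_closure_of by (meson disjoint_iff)
    have "\<exists>U V. openin wstar U \<and> openin (prod_topology wstar euclideanreal) V \<and> u \<in> U \<and> (w', \<alpha>) \<in> V \<and> U \<times> V \<subseteq> T"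
      by (rule openin_prod_topology_alt[THEN iffD1, rule_format, OF T(1)[unfolded \<tau>_def] T(2)])
    then obtain U V where UV: "openin wstar U" "openin (prod_topology wstar euclideanreal) V"
      "u \<in> U" "(w', \<alpha>) \<in> V" "U \<times> V \<subseteq> T" by blast
    have "\<exists>V1 V2. openin wstar V1 \<and> openin euclideanreal V2 \<and> w' \<in> V1 \<and> \<alpha> \<in> V2 \<and> V1 \<times> V2 \<subseteq> V"
      by (rule openin_prod_topology_alt[THEN iffD1, rule_format, OF UV(2,4)])
    then obtain V1 V2 where V12: "openin wstar V1" "openin euclideanreal V2" "w' \<in> V1" "\<alpha> \<in> V2" "V1 \<times> V2 \<subseteq> V"
      by blast
    have "open V2" using V12(2) by simp
    obtain F1 \<epsilon>1 where F1: "finite F1" "0 < \<epsilon>1" "\<And>z. (\<And>f. f \<in> F1 \<Longrightarrow> \<bar>blinfun_apply z f - blinfun_apply u f\<bar> < \<epsilon>1) \<Longrightarrow> z \<in> U"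
      using openin_wstar_basic[OF UV(1,3)] by metis
    obtain F2 \<epsilon>2 where F2: "finite F2" "0 < \<epsilon>2" "\<And>z. (\<And>f. f \<in> F2 \<Longrightarrow> \<bar>blinfun_apply z f - blinfun_apply w' f\<bar> < \<epsilon>2) \<Longrightarrow> z \<in> V1"
      using openin_wstar_basic[OF V12(1,3)] by metis
    obtain \<epsilon>3 where e3: "0 < \<epsilon>3" "\<And>r. \<bar>r - \<alpha>\<bar> < \<epsilon>3 \<Longrightarrow> r \<in> V2"
      using \<open>open V2\<close> V12(4) unfolding open_dist dist_real_def by blast
    define \<epsilon> where "\<epsilon> = min \<epsilon>1 (min \<epsilon>2 \<epsilon>3)"
    have \<epsilon>: "0 < \<epsilon>" "\<epsilon> \<le> \<epsilon>1" "\<epsilon> \<le> \<epsilon>2" "\<epsilon> \<le> \<epsilon>3" unfolding \<epsilon>_def using F1(2) F2(2) e3(1) by auto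
    define P1 where "P1 a = (\<Sum>f\<in>F1. \<bar>blinfun_apply a f\<bar>)" for a :: "'x dual"
    define P2 where "P2 a = (\<Sum>f\<in>F2. \<bar>blinfun_apply a f\<bar>)" for a :: "'y bidual"
    define P where "P e = P1 (fst e) + P2 (fst (snd e)) + \<bar>snd (snd e)\<bar>" for e :: "'x dual \<times> 'y bidual \<times> real"
    have P1: "sublinear P1" unfolding P1_def
      by (rule sublinear_sum_abs) (auto intro!: linearI simp: blinfun.add_left blinfun.scaleR_left)
    have P2: "sublinear P2" unfolding P2_def
      by (rule sublinear_sum_abs) (auto intro!: linearI simp: blinfun.add_left blinfun.scaleR_left)
    have P: "sublinear P" unfolding sublinear_def
    proof (intro conjI allI impI)
      fix x y
      show "P (x + y) \<le> P x + P y"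
        unfolding P_def using sublinearD(1)[OF P1, of "fst x" "fst y"] sublinearD(1)[OF P2, of "fst (snd x)" "fst (snd y)"]
          abs_triangle_ineq[of "snd (snd x)" "snd (snd y)"] by simp
    next
      fix c :: real and x assume "0 \<le> c"
      then show "P (c *\<^sub>R x) = c * P x"
        unfolding P_def using sublinearD(2)[OF P1, of c "fst x"] sublinearD(2)[OF P2, of c "fst (snd x)"]
        by (simp add: abs_mult distrib_left)
    qed
    define S where "S = {((adjoint A v - u, z - w', r - \<alpha>), 0::real) | v z r. fconj h (v, z) \<le> ereal r}"
    have SI: "((adjoint A v - u, z - w', r - \<alpha>), 0::real) \<in> S" if "fconj h (v, z) \<le> ereal r" for v z r
      unfolding S_def using that by blast
    have Sne: "S \<noteq> {}" using SI[OF strong_representative_conj_at_contact[OF h contact]] by blast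
    have Scv: "convex S"
    proof (rule convexI)
      fix p1 p2 and a b :: real
      assume p: "p1 \<in> S" "p2 \<in> S" and ab: "0 \<le> a" "0 \<le> b" "a + b = 1"
      obtain v z r where 1: "p1 = ((adjoint A v - u, z - w', r - \<alpha>), 0)" "fconj h (v, z) \<le> ereal r"
        using p(1) unfolding S_def by blast
      obtain v' z' r' where 2: "p2 = ((adjoint A v' - u, z' - w', r' - \<alpha>), 0)" "fconj h (v', z') \<le> ereal r'"
        using p(2) unfolding S_def by blast
      have "fconj h (a *\<^sub>R v + b *\<^sub>R v', a *\<^sub>R z + b *\<^sub>R z') \<le> ereal (a * r + b * r')"
        unfolding fconj_le_iff
      proof (intro allI impI)
        fix x'' v'' s assume hs: "h (x'', v'') \<le> ereal s"
        have "a * (blinfun_apply v x'' + blinfun_apply z v'' - s) + b * (blinfun_apply v' x'' + blinfun_apply z' v'' - s) \<le> a * r + b * r'"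
          using 1(2) 2(2) hs ab unfolding fconj_le_iff by (intro add_mono mult_left_mono) auto
        moreover have "a * s + b * s = s" using ab(3) by (simp flip: distrib_right)
        ultimately show "blinfun_apply (a *\<^sub>R v + b *\<^sub>R v') x'' + blinfun_apply (a *\<^sub>R z + b *\<^sub>R z') v'' - s \<le> a * r + b * r'"
          by (simp add: blinfun.add_left blinfun.scaleR_left algebra_simps)
      qed
      from SI[OF this] have "((adjoint A (a *\<^sub>R v + b *\<^sub>R v') - u, a *\<^sub>R z + b *\<^sub>R z' - w', a * r + b * r' - \<alpha>), 0) \<in> S" .
      moreover have "adjoint A (a *\<^sub>R v + b *\<^sub>R v') = a *\<^sub>R adjoint A v + b *\<^sub>R adjoint A v'"
        by (intro blinfun_eqI) (simp add: blinfun.add_left blinfun.scaleR_left)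
      moreover have "u = a *\<^sub>R u + b *\<^sub>R u" "w' = a *\<^sub>R w' + b *\<^sub>R w'" "\<alpha> = a * \<alpha> + b * \<alpha>"
        using ab(3) by (simp_all flip: scaleR_add_left distrib_right)
      ultimately show "a *\<^sub>R p1 + b *\<^sub>R p2 \<in> S"
        unfolding 1(1) 2(1) by (simp add: algebra_simps)
    qed
    have "\<epsilon> \<le> P e + k" if ek: "(e, k) \<in> S" for e k
    proof (rule ccontr)
      assume "\<not> \<epsilon> \<le> P e + k"
      moreover obtain v z r where vzr: "e = (adjoint A v - u, z - w', r - \<alpha>)" "k = 0" "fconj h (v, z) \<le> ereal r"
        using ek unfolding S_def by blast
      ultimately have lt: "P1 (adjoint A v - u) + P2 (z - w') + \<bar>r - \<alpha>\<bar> < \<epsilon>" unfolding P_def by simp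
      have nn: "0 \<le> P1 (adjoint A v - u)" "0 \<le> P2 (z - w')" unfolding P1_def P2_def by (auto intro: sum_nonneg)
      have "adjoint A v \<in> U"
      proof (rule F1(3))
        fix f assume "f \<in> F1"
        then have "\<bar>blinfun_apply (adjoint A v - u) f\<bar> \<le> P1 (adjoint A v - u)"
          unfolding P1_def using F1(1) by (intro member_le_sum) auto
        then show "\<bar>blinfun_apply (adjoint A v) f - blinfun_apply u f\<bar> < \<epsilon>1"
          using lt nn \<epsilon>(2) unfolding blinfun.diff_left by linarith
      qed
      moreover have "z \<in> V1"
      proof (rule F2(3))
        fix f assume "f \<in> F2"
        then have "\<bar>blinfun_apply (z - w') f\<bar> \<le> P2 (z - w')"
          unfolding P2_def using F2(1) by (intro member_le_sum) auto
        then show "\<bar>blinfun_apply z f - blinfun_apply w' f\<bar> < \<epsilon>2"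
          using lt nn \<epsilon>(3) unfolding blinfun.diff_left by linarith
      qed
      moreover have "r \<in> V2" using lt nn \<epsilon>(4) by (intro e3(2)) linarith
      ultimately have "(adjoint A v, z, r) \<in> T" using UV(5) V12(5) by blast
      moreover have "(adjoint A v, z, r) \<in> Q" unfolding Q_def using vzr(3) by blast
      ultimately show False using T(3) by blast
    qed
    then obtain L where L: "linear L" "\<And>e. L e \<le> P e" "\<And>e k. (e, k) \<in> S \<Longrightarrow> \<epsilon> \<le> L e + k"
      using mazur_orlicz[OF P Scv Sne, of \<epsilon>] by blast
    have L1: "linear (\<lambda>a. L (a, 0, 0))" "linear (\<lambda>a. L (0, a, 0))"
    proof -
      have "linear (\<lambda>a::'x dual. (a, 0::'y bidual, 0::real))" "linear (\<lambda>a::'y bidual. (0::'x dual, a, 0::real))"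
        by (auto intro!: linearI)
      from this[THEN linear_compose[OF _ L(1)]]
      show "linear (\<lambda>a. L (a, 0, 0))" "linear (\<lambda>a. L (0, a, 0))" unfolding o_def .
    qed
    have P0: "P1 0 = 0" "P2 0 = 0" using sublinear_zero P1 P2 by auto
    obtain x1 where x1: "\<And>a. L (a, 0, 0) = blinfun_apply a x1"
      using linear_functional_evaluation_le[OF F1(1) L1(1)] L(2)[of "(_, 0, 0)"] P0 unfolding P_def P1_def P2_def by auto
    obtain v2 where v2: "\<And>a. L (0, a, 0) = blinfun_apply a v2"
      using linear_functional_evaluation_le[OF F2(1) L1(2)] L(2)[of "(0, _, 0)"] P0 unfolding P_def P1_def P2_def by auto
    define t where "t = L (0, 0, 1)"
    have Lsplit: "L (a, z, r) = blinfun_apply a x1 + blinfun_apply z v2 + r * t" for a z r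
    proof -
      have "(a, z, r) = (a, 0, 0) + (0, z, 0) + r *\<^sub>R (0, 0, 1)" by simp
      then show ?thesis unfolding x1[symmetric] v2[symmetric] t_def
        by (simp only: linear_add[OF L(1)] linear_cmul[OF L(1)]) simp
    qed
    define c where "c = blinfun_apply u x1 + blinfun_apply w' v2"
    have sep: "c + \<epsilon> \<le> blinfun_apply v (blinfun_apply A x1) + blinfun_apply z v2 + (r - \<alpha>) * t"
      if "fconj h (v, z) \<le> ereal r" for v z r
      using L(3)[OF SI[OF that]] unfolding Lsplit c_def by (simp add: blinfun.diff_left)
    have c1: "fconj h (v1, bidual_emb y1) \<le> ereal (blinfun_apply v1 y1)"
      by (rule strong_representative_conj_at_contact[OF h contact])
    have t0: "0 \<le> t"
    proof (rule ccontr)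
      assume t: "\<not> 0 \<le> t"
      define B where "B = blinfun_apply v1 (blinfun_apply A x1) + blinfun_apply (bidual_emb y1) v2 - c - \<epsilon> - \<alpha> * t"
      \<comment> \<open>Heights above the conjugate can be raised at will; with t < 0 this one
        pushes the right side of \<open>sep\<close> below the left.\<close>
      define r where "r = max (blinfun_apply v1 y1) ((B + 1) / (- t))"
      have "fconj h (v1, bidual_emb y1) \<le> ereal r" unfolding r_def using c1 by (meson ereal_less_eq(3) max.cobounded1 order_trans)
      from sep[OF this] have "0 \<le> B + r * t" unfolding B_def by (simp add: algebra_simps)
      moreover have "(B + 1) / (- t) \<le> r" unfolding r_def by simp
      then have "B + 1 \<le> r * (- t)" using t by (subst (asm) pos_divide_le_eq) auto
      ultimately show False by simp
    qed
    show False
    proof (cases "t = 0")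
      case False
      with t0 have t: "0 < t" by simp
      \<comment> \<open>Dividing by t turns \<open>sep\<close> into an upper bound over the epigraph
        of the conjugate, hence by Fenchel-Moreau into a bound for h at (A x2, v3) that is too low
        by \<epsilon> / t.\<close>
      define x2 where "x2 = - (inverse t *\<^sub>R x1)"
      define v3 where "v3 = - (inverse t *\<^sub>R v2)"
      have "h (blinfun_apply A x2, v3) \<le> ereal (- c / t - \<alpha> - \<epsilon> / t)"
      proof (rule strong_representative_fenchel_moreau[OF h contact])
        fix p q r assume "fconj h (p, q) \<le> ereal r"
        define X where "X = blinfun_apply p (blinfun_apply A x1) + blinfun_apply q v2"
        have "c + \<epsilon> \<le> X + (r - \<alpha>) * t"
          using sep[OF \<open>fconj h (p, q) \<le> ereal r\<close>] unfolding X_def by simp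
        then have "(c + \<epsilon>) / t \<le> (X + (r - \<alpha>) * t) / t"
          using t by (simp add: divide_right_mono)
        also have "\<dots> = X / t + (r - \<alpha>)" using t by (simp add: add_divide_distrib)
        finally have "- (X / t) - r \<le> - c / t - \<alpha> - \<epsilon> / t" by (simp add: add_divide_distrib)
        moreover have "blinfun_apply p (blinfun_apply A x2) + blinfun_apply q v3 = - (X / t)"
          unfolding x2_def v3_def X_def
          by (simp add: blinfun.minus_right blinfun.scaleR_right divide_inverse distrib_left mult.commute)
        ultimately show "blinfun_apply p (blinfun_apply A x2) + blinfun_apply q v3 - r \<le> - c / t - \<alpha> - \<epsilon> / t"
          by simp
      qed
      from bound[OF this] have "- c / t + c / t + \<alpha> + \<epsilon> / t \<le> \<alpha>"
        unfolding c_def w'_def x2_def v3_def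
        by (simp add: blinfun.minus_right blinfun.scaleR_right linear_neg[OF bounded_linear.linear[OF bounded_linear_adjoint]]
            linear_cmul[OF bounded_linear.linear[OF bounded_linear_adjoint]] divide_inverse algebra_simps)
      then have "\<epsilon> / t \<le> 0" by simp
      then show False using divide_pos_pos[OF \<epsilon>(1) t] by linarith
    next
      case True
      \<comment> \<open>Along - (A x1, v2) the function h falls at rate at least c + \<epsilon>,
        while the linear part of \<open>bound\<close> falls only at rate c; the surplus l \<epsilon>
        is unbounded in l.\<close>
      have le: "blinfun_apply u (x0 - l *\<^sub>R x1) + blinfun_apply w' (v0 - l *\<^sub>R v2) - (s0 - l * (c + \<epsilon>)) \<le> \<alpha>" if l: "0 \<le> l" for l
      proof -
        have "h (blinfun_apply A (x0 - l *\<^sub>R x1), v0 - l *\<^sub>R v2) \<le> ereal (s0 - l * (c + \<epsilon>))"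
        proof (rule strong_representative_fenchel_moreau[OF h contact])
          fix p q r assume pqr: "fconj h (p, q) \<le> ereal r"
          have "l * (c + \<epsilon>) \<le> l * (blinfun_apply p (blinfun_apply A x1) + blinfun_apply q v2)"
            using sep[OF pqr] True l by (intro mult_left_mono) auto
          moreover have "blinfun_apply p (blinfun_apply A x0) + blinfun_apply q v0 - s0 \<le> r"
            using pqr dom unfolding fconj_le_iff by blast
          ultimately show "blinfun_apply p (blinfun_apply A (x0 - l *\<^sub>R x1)) + blinfun_apply q (v0 - l *\<^sub>R v2) - r \<le> s0 - l * (c + \<epsilon>)"
            by (simp add: blinfun.diff_right blinfun.scaleR_right algebra_simps)
        qed
        from bound[OF this] show ?thesis unfolding w'_def by simp
      qed
      define B where "B = \<alpha> + s0 - blinfun_apply u x0 - blinfun_apply w' v0"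
      have B: "l * \<epsilon> \<le> B" if "0 \<le> l" for l
        using le[OF that] unfolding B_def c_def
        by (simp add: blinfun.diff_right blinfun.scaleR_right algebra_simps)
      have "0 \<le> B" using B[of 0] by simp
      then have "(B + 1) / \<epsilon> * \<epsilon> \<le> B" using \<epsilon>(1) by (intro B) simp
      then show False using \<epsilon>(1) by simp
    qed
  qed
  moreover have "(u, w', \<alpha>) \<in> UNIV \<times> range (biadjoint A) \<times> UNIV" unfolding w'_def by simp
  ultimately have "(u, w', \<alpha>) \<in> Q"
    using cl unfolding closed_regarding_def \<tau>_def Q_def by blast
  then show ?thesis unfolding Q_def w'_def by blast
qed

section \<open>The composed operator\<close>

text \<open>Translation upwards maps the epigraph into itself and commutes with closure, so the
  closure is upward closed; being closed, it also contains the infimum of each vertical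
  section.\<close>

lemma epigraph_lsc_hull:
  fixes f :: "'b::real_normed_vector \<Rightarrow> ereal"
  shows "epigraph (lsc_hull f) = closure (epigraph f)"
proof (intro subset_antisym subsetI)
  fix z assume "z \<in> closure (epigraph f)"
  then show "z \<in> epigraph (lsc_hull f)"
    unfolding epigraph_def[of "lsc_hull f"] lsc_hull_def by (cases z) (auto intro!: Inf_lower)
next
  fix z assume z: "z \<in> epigraph (lsc_hull f)"
  obtain p r where pr: "z = (p, r)" by fastforce
  have up: "(p, r + e) \<in> closure (epigraph f)" if "0 < e" for e
  proof -
    have "Inf {ereal r | r. (p, r) \<in> closure (epigraph f)} < ereal (r + e)"
      using z that unfolding pr epigraph_def[of "lsc_hull f"] lsc_hull_def
      by (auto intro: order.strict_trans1)
    then obtain r' where r': "(p, r') \<in> closure (epigraph f)" "r' < r + e"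
      unfolding Inf_less_iff by auto
    have "(\<lambda>q. (0, r + e - r') + q) ` closure (epigraph f) \<subseteq> closure (epigraph f)"
      unfolding closure_translation[symmetric]
    proof (rule closure_mono, rule subsetI)
      fix q assume "q \<in> (\<lambda>q. (0, r + e - r') + q) ` epigraph f"
      then obtain q1 q2 where "f q1 \<le> ereal q2" "q = (q1, r + e - r' + q2)" unfolding epigraph_def by auto
      moreover have "ereal q2 \<le> ereal (r + e - r' + q2)" using r'(2) by simp
      ultimately show "q \<in> epigraph f" unfolding epigraph_def using order_trans by fastforce
    qed
    then show ?thesis using r'(1) by force
  qed
  have "(\<lambda>n. (p, r + inverse (real (Suc n)))) \<longlonglongrightarrow> (p, r + 0)"
    by (intro tendsto_intros LIMSEQ_inverse_real_of_nat)
  then have "(p, r + 0) \<in> closure (epigraph f)"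
    by (rule closed_sequentially[OF closed_closure, rotated]) (auto intro: up)
  then show "z \<in> closure (epigraph f)" unfolding pr by simp
qed

text \<open>The infimum in \<open>rep_comp\<close> need not be attained, but raising the height by e
  / 2 provides a witness v, and the closure absorbs the difference. The hull can then be handled
  through explicit v.\<close>

lemma epigraph_lsc_hull_rep_comp:
  "epigraph (lsc_hull (rep_comp A h)) = closure {((x, adjoint A v), r) | x v r. h (blinfun_apply A x, v) \<le> ereal r}"
  (is "_ = closure ?E")
  unfolding epigraph_lsc_hull
proof (intro subset_antisym closure_minimal closed_closure)
  show "?E \<subseteq> closure (epigraph (rep_comp A h))"
    using closure_subset by (fastforce simp: epigraph_def rep_comp_def intro: Inf_lower2)
next
  show "epigraph (rep_comp A h) \<subseteq> closure ?E"
  proof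
    fix z assume "z \<in> epigraph (rep_comp A h)"
    then obtain p r where pr: "z = (p, r)" "rep_comp A h p \<le> ereal r" unfolding epigraph_def by auto
    show "z \<in> closure ?E"
      unfolding closure_approachable
    proof (intro allI impI)
      fix e :: real assume e: "0 < e"
      then have "rep_comp A h p < ereal (r + e / 2)" using pr(2) by (auto intro: order.strict_trans1)
      then obtain v where "adjoint A v = snd p" "h (blinfun_apply A (fst p), v) < ereal (r + e / 2)"
        unfolding rep_comp_def Inf_less_iff by auto
      then have "(p, r + e / 2) \<in> ?E" by (cases p) (auto intro: less_imp_le)
      moreover have "dist (p, r + e / 2) z < e" unfolding pr(1) dist_norm using e by simp
      ultimately show "\<exists>y\<in>?E. dist y z < e" by blast
    qed
  qed
qed

theorem theorem4p6:
  fixes A :: "'x::banach \<Rightarrow>\<^sub>L 'y::banach"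
    and G :: "('y \<times> 'y dual) set"
    and hT :: "'y \<times> 'y dual \<Rightarrow> ereal"
  assumes X_nonzero: "\<exists>x::'x. x \<noteq> 0"
    and Y_nonzero: "\<exists>y::'y. y \<noteq> 0"
    and T_D: "gossez_D G"
    and hT_strong: "strong_representative hT G"
    and dom_im: "fst ` effdom hT \<inter> range (blinfun_apply A) \<noteq> {}"
    and cond: "0 \<in> ic (set_diff_mink (fst ` effdom hT) (range (blinfun_apply A)))
      \<or> closed_regarding (prod_topology wstar (prod_topology wstar euclideanreal))
          {(adjoint A v, w, r) | v w r. fconj hT (v, w) \<le> ereal r}
          (UNIV \<times> range (biadjoint A) \<times> UNIV)"
  shows "strong_representative (lsc_hull (rep_comp A hT)) (comp_op A G)
    \<and> gossez_D (comp_op A G)"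
proof -
  define H where "H = lsc_hull (rep_comp A hT)"
  define E where "E = {((x, adjoint A v), r) | x v r. hT (blinfun_apply A x, v) \<le> ereal r}"
  have epiH: "epigraph H = closure E" unfolding H_def E_def by (rule epigraph_lsc_hull_rep_comp)
  have HI: "H (x, adjoint A v) \<le> ereal r" if "hT (blinfun_apply A x, v) \<le> ereal r" for x v r
  proof -
    have "((x, adjoint A v), r) \<in> E" unfolding E_def using that by blast
    then have "((x, adjoint A v), r) \<in> epigraph H" unfolding epiH by (rule subsetD[OF closure_subset])
    then show ?thesis unfolding epigraph_def by simp
  qed
  obtain y where y: "y \<in> fst ` effdom hT" "y \<in> range (blinfun_apply A)"
    using dom_im by (meson disjoint_iff)
  obtain p0 where p0: "p0 \<in> effdom hT" "y = fst p0" using y(1) by (rule imageE)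
  obtain x0 where x0: "y = blinfun_apply A x0" using y(2) by (rule rangeE)
  have "p0 = (blinfun_apply A x0, snd p0)" using p0(2) x0 by (metis prod.collapse)
  then obtain v0 where "hT (blinfun_apply A x0, v0) < \<infinity>"
    using p0(1) unfolding effdom_def by (metis mem_Collect_eq)
  then obtain s0 where s0: "hT (blinfun_apply A x0, v0) \<le> ereal s0"
    by (cases "hT (blinfun_apply A x0, v0)") auto
  have maxG: "(y, v) \<in> G" if "\<And>y' v'. (y', v') \<in> G \<Longrightarrow> 0 \<le> blinfun_apply (v - v') (y - y')" for y v
    using T_D that unfolding gossez_D_def maximal_monotone_def by blast
  have Gc: "hT (y, v) \<le> ereal (blinfun_apply v y)" if "(y, v) \<in> G" for y v
    using hT_strong that unfolding strong_representative_def representative_def coupling_def by force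
  \<comment> \<open>If G were empty, (0, 0) would be vacuously related to it and belong to it by
    maximality.\<close>
  have "G \<noteq> {}" using maxG[of 0 0] by auto
  then obtain y1 v1 where "(y1, v1) \<in> G" by auto
  then have contact: "hT (y1, v1) \<le> ereal (blinfun_apply v1 y1)" by (rule Gc)
  have attained: "\<exists>v0. adjoint A v0 = u \<and> fconj hT (v0, biadjoint A w) \<le> ereal \<alpha>"
    if Hle: "fconj H (u, w) \<le> ereal \<alpha>" for u w \<alpha>
  proof -
    have bound: "blinfun_apply u x + blinfun_apply w (adjoint A v) - s \<le> \<alpha>" if "hT (blinfun_apply A x, v) \<le> ereal s" for x v s
      using Hle HI[OF that] unfolding fconj_le_iff by blast
    show ?thesis
      using cond
    proof
      assume "0 \<in> ic (set_diff_mink (fst ` effdom hT) (range (blinfun_apply A)))"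
      then show ?thesis
        using conjugate_attained_ic strong_representative_convex strong_representative_closed hT_strong dom_im bound by blast
    next
      assume "closed_regarding (prod_topology wstar (prod_topology wstar euclideanreal))
          {(adjoint A v, w, r) | v w r. fconj hT (v, w) \<le> ereal r} (UNIV \<times> range (biadjoint A) \<times> UNIV)"
      then show ?thesis by (rule conjugate_attained_closed[OF hT_strong contact s0]) (rule bound)
    qed
  qed
  have strong: "strong_representative H (comp_op A G)"
    unfolding strong_representative_def representative_def
  proof (intro conjI allI ballI)
    have "convex E"
    proof (rule convexI)
      fix p1 p2 and a b :: real
      assume p: "p1 \<in> E" "p2 \<in> E" and ab: "0 \<le> a" "0 \<le> b" "a + b = 1"
      obtain x v r where 1: "p1 = ((x, adjoint A v), r)" "hT (blinfun_apply A x, v) \<le> ereal r"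
        using p(1) unfolding E_def by blast
      obtain x' v' r' where 2: "p2 = ((x', adjoint A v'), r')" "hT (blinfun_apply A x', v') \<le> ereal r'"
        using p(2) unfolding E_def by blast
      have "a *\<^sub>R ((blinfun_apply A x, v), r) + b *\<^sub>R ((blinfun_apply A x', v'), r') \<in> epigraph hT"
        by (rule convexD[OF strong_representative_convex[OF hT_strong]]) (use 1 2 ab in \<open>auto simp: epigraph_def\<close>)
      then have "((a *\<^sub>R x + b *\<^sub>R x', adjoint A (a *\<^sub>R v + b *\<^sub>R v')), a * r + b * r') \<in> E"
        unfolding E_def epigraph_def by (auto simp: blinfun.add_right blinfun.scaleR_right)
      moreover have "adjoint A (a *\<^sub>R v + b *\<^sub>R v') = a *\<^sub>R adjoint A v + b *\<^sub>R adjoint A v'"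
        by (intro blinfun_eqI) (simp add: blinfun.add_left blinfun.scaleR_left)
      ultimately show "a *\<^sub>R p1 + b *\<^sub>R p2 \<in> E" unfolding 1(1) 2(1) by simp
    qed
    then show "ereal_convex H" unfolding ereal_convex_def epiH by (rule convex_closure)
    show "ereal_lsc H" unfolding ereal_lsc_def epiH by simp
    \<comment> \<open>On \<open>E\<close> the pairing of x with A* v is that of A x with v, so hT
      \<ge> c applies; continuity of the pairing carries the inequality to the closure.\<close>
    have "epigraph H \<subseteq> {z. blinfun_apply (snd (fst z)) (fst (fst z)) \<le> snd z}"
      unfolding epiH
    proof (rule closure_minimal)
      show "E \<subseteq> {z. blinfun_apply (snd (fst z)) (fst (fst z)) \<le> snd z}"
        unfolding E_def using strong_representative_ge[OF hT_strong] by auto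
      show "closed {z :: ('x \<times> 'x dual) \<times> real. blinfun_apply (snd (fst z)) (fst (fst z)) \<le> snd z}"
        by (intro closed_Collect_le continuous_intros)
    qed
    note sub = this
    have ge: "blinfun_apply (snd p) (fst p) \<le> r" if "H p \<le> ereal r" for p r
    proof -
      have "(p, r) \<in> epigraph H" using that unfolding epigraph_def by simp
      from subsetD[OF sub this] show ?thesis by simp
    qed
    show Hc: "coupling p \<le> H p" for p
    proof (cases "H p")
      case (real r)
      then show ?thesis using ge[of p r] unfolding coupling_def by simp
    next
      case MInf
      then show ?thesis using ge[of p "blinfun_apply (snd p) (fst p) - 1"] by simp
    qed simp
    fix p assume "p \<in> comp_op A G"
    then obtain x v where xv: "p = (x, adjoint A v)" "(blinfun_apply A x, v) \<in> G" unfolding comp_op_def by auto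
    have "H p \<le> coupling p" using HI[OF Gc[OF xv(2)]] unfolding xv(1) coupling_def by simp
    then show "H p = coupling p" using Hc[of p] by simp
  next
    fix u w
    show "ereal (blinfun_apply w u) \<le> fconj H (u, w)"
    proof (rule ccontr)
      assume "\<not> ?thesis"
      then have "fconj H (u, w) < ereal (blinfun_apply w u)" by simp
      \<comment> \<open>Exactness is stated for real levels, and at this point the conjugate might
        still be -infinity.\<close>
      then obtain \<alpha> where \<alpha>: "fconj H (u, w) < ereal \<alpha>" "ereal \<alpha> < ereal (blinfun_apply w u)"
        using ereal_dense2 by blast
      then obtain v where v: "adjoint A v = u" "fconj hT (v, biadjoint A w) \<le> ereal \<alpha>"
        using attained less_imp_le by blast
      have "ereal (blinfun_apply (biadjoint A w) v) \<le> fconj hT (v, biadjoint A w)"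
        using hT_strong unfolding strong_representative_def by blast
      then have "ereal (blinfun_apply w u) \<le> ereal \<alpha>" using v order_trans by fastforce
      then show False using \<alpha>(2) by simp
    qed
  qed
  have "(x, u) \<in> comp_op A G" if Hle: "H (x, u) \<le> ereal (blinfun_apply u x)" for x u
  proof -
    obtain v where v: "adjoint A v = u" "fconj hT (v, biadjoint A (bidual_emb x)) \<le> ereal (blinfun_apply u x)"
      using attained[OF strong_representative_conj_at_contact[OF strong Hle]] by blast
    have "(blinfun_apply A x, v) \<in> G"
    proof (rule maxG)
      fix y' v' assume "(y', v') \<in> G"
      \<comment> \<open>On G the value of hT is the coupling; with u x = v (A x) the conjugate bound
        rearranges to (v - v') (A x - y') \<ge> 0.\<close>
      then have "blinfun_apply v y' + blinfun_apply (biadjoint A (bidual_emb x)) v' - blinfun_apply v' y' \<le> blinfun_apply u x"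
        using v(2) Gc unfolding fconj_le_iff by blast
      then show "0 \<le> blinfun_apply (v - v') (blinfun_apply A x - y')"
        unfolding v(1)[symmetric] by (simp add: blinfun.diff_left blinfun.diff_right)
    qed
    then show ?thesis using v(1) unfolding comp_op_def by blast
  qed
  moreover have "effdom H \<noteq> {}" using HI[OF s0] unfolding effdom_def by (force simp: less_ereal.simps)
  ultimately have "gossez_D (comp_op A G)" by (intro strong_representative_gossez_D[OF strong])
  then show ?thesis using strong unfolding H_def by blast
qed

end
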